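(* Let $I$ be a regular proper ideal in a Noetherian ring $R$, let $(V,N)$ be a Rees valuation ring of $I$, let $(W,Q)$ be the Rees valuation ring of $uR[u,tI]$ that corresponds to $(V,N)$, and let $(U_k,P_k)$ be the Itoh $(k)$-valuation ring of $I$ that corresponds to $(V,N)$, where $k\ge 2$ is an arbitrary integer. Assume that $IV=N^e$. For a domain $A$ let $A_{(0)}$ denote its quotient field. Then the following hold: (1) If $e$ is a multiple of $k$, then $P_k=NU_k$ and $[(U_k)_{(0)}:W_{(0)}]=k=[(U_k/P_k):(W/Q)]$. (2) If $e$ and $k$ are relatively prime, then $NU_k=P_k^{\,k}$, $[(U_k)_{(0)}:W_{(0)}]=k$, and $U_k/P_k\cong W/Q$. (3) If the greatest common divisor of $e$ and $k$ is $d$, and if $c$ is the positive integer such that $cd=k$, then $NU_k=P_k^{\,c}$, $[(U_k)_{(0)}:W_{(0)}]=k$, and $[(U_k/P_k):(W/Q)]=d$.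
   Context: Rings are commutative with $1\neq 0$. $A'$ denotes the integral closure of a ring $A$ in its total quotient ring. An ideal is regular if it contains a regular element (nonzerodivisor). Rees valuation rings. Let $I$ be a regular proper ideal in a Noetherian ring $R$, generated by regular elements $b_1,\dots,b_g$. For each $i$ let $C_i=R[I/b_i]$ (a subring of the total quotient ring of $R$). For each (necessarily height one) associated prime $p$ of $b_iC_i'$ let $z$ be the unique minimal prime of $C_i'$ contained in $p$; then $(C_i'/z)_{(p/z)}$ is a DVR. The set of all DVRs so obtained is the set of Rees valuation rings of $I$; it does not depend on the choice of generators. $t$ is an indeterminate, $u=1/t$, $\mathbf R=R[u,tI]\subseteq R[u,t]$, and $t^{1/k}=1/u^{1/k}$. If $V=(R[I/b_i]'/z)_{(p/z)}$ is a Rees valuation ring of $I$ with maximal ideal $N$, the corresponding Rees valuation ring of $u\mathbf R$ is $W=V[t\overline{b_i}]_{NV[t\overline{b_i}]}$, where $\overline{b_i}=b_i+z$, with maximal ideal $Q=NW$; this is a bijection between the Rees valuation rings of $I$ and those of $u\mathbf R$. If $F$ is the quotient field of $V$, then $W$ has quotient field $F(u)$. Let $\mathbf T_k=R[u,tI,u^{1/k}]'\cap R[u^{1/k},t^{1/k}]$. The Itoh $(k)$-valuation rings of $I$ are the DVRs $(\mathbf T_k/z)_{(p/z)}$, where $p$ runs over the (height one) associated primes of $u^{1/k}\mathbf T_k$ and $z$ is the unique minimal prime of $\mathbf T_k$ contained in $p$. They are in bijection with the Rees valuation rings $W$ of $u\mathbf R$: the one corresponding to $W$, with quotient field $F(u)$,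 is the integral closure of $W$ in $F(u^{1/k})$. The Itoh $(k)$-valuation ring of $I$ that corresponds to $(V,N)$ is the one corresponding to the $W$ that corresponds to $V$. *)

theory Defs
  imports
    "HOL-Algebra.Ring_Divisibility"
    "HOL-Algebra.Ideal_Product"
    "HOL-Algebra.Generated_Rings"
    "HOL-Algebra.Embedded_Algebras"
    "HOL-Computational_Algebra.Polynomial"
    "HOL-Computational_Algebra.Fraction_Field"
begin

section \<open>Subrings of a type as HOL-Algebra rings\<close>

definition ring_of :: "'a::comm_ring_1 set \<Rightarrow> 'a ring" where
  "ring_of A = \<lparr>carrier = A, mult = (*), one = 1, zero = 0, add = (+)\<rparr>"

lemma ring_of_simps [simp]:
  "carrier (ring_of A) = A"
  "mult (ring_of A) x y = x * y"
  "one (ring_of A) = 1"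
  "zero (ring_of A) = 0"
  "add (ring_of A) x y = x + y"
  by (simp_all add: ring_of_def)

lemma cring_ring_of_UNIV: "cring (ring_of (UNIV :: 'a::comm_ring_1 set))"
proof (rule cringI)
  show "abelian_group (ring_of (UNIV :: 'a set))"
    by (rule abelian_groupI) (auto simp: algebra_simps intro: exI[of _ "- x" for x])
  show "comm_monoid (ring_of (UNIV :: 'a set))"
    by (rule comm_monoidI) (auto simp: algebra_simps)
qed (auto simp: algebra_simps)

abbreviation generated_subring :: "'a::comm_ring_1 set \<Rightarrow> 'a set" where
  "generated_subring H \<equiv> generate_ring (ring_of UNIV) H"


section \<open>The total quotient ring\<close>

definition nonzerodivisor :: "'a::comm_ring_1 \<Rightarrow> bool" where
  "nonzerodivisor a \<longleftrightarrow> (\<forall>x. a * x = 0 \<longrightarrow> x = 0)"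

lemma nonzerodivisor_1 [simp]: "nonzerodivisor 1"
  by (simp add: nonzerodivisor_def)

lemma nonzerodivisor_mult [simp]:
  "nonzerodivisor a \<Longrightarrow> nonzerodivisor b \<Longrightarrow> nonzerodivisor (a * b)"
  unfolding nonzerodivisor_def mult.assoc by blast

lemma nonzerodivisor_cancel:
  assumes "nonzerodivisor a" "a * x = a * y"
  shows "x = y"
proof -
  have "a * (x - y) = 0"
    using assms(2) by (simp add: algebra_simps)
  then show ?thesis
    using assms(1) unfolding nonzerodivisor_def by (metis right_minus_eq)
qed

definition tqrel :: "'a::comm_ring_1 \<times> 'a \<Rightarrow> 'a \<times> 'a \<Rightarrow> bool" where
  "tqrel x y \<longleftrightarrow>
     nonzerodivisor (snd x) \<and> nonzerodivisor (snd y) \<and> fst x * snd y = fst y * snd x"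

lemma part_equivp_tqrel: "part_equivp (tqrel :: 'a::comm_ring_1 \<times> 'a \<Rightarrow> _)"
proof (rule part_equivpI)
  show "\<exists>x :: 'a \<times> 'a. tqrel x x"
    by (rule exI[of _ "(0, 1)"]) (simp add: tqrel_def)
  show "symp (tqrel :: 'a \<times> 'a \<Rightarrow> _)"
    by (simp add: symp_def tqrel_def)
  show "transp (tqrel :: 'a \<times> 'a \<Rightarrow> _)"
  proof (rule transpI)
    fix x y z :: "'a \<times> 'a"
    assume xy: "tqrel x y" and yz: "tqrel y z"
    have 1: "fst x * snd y = fst y * snd x" and 2: "fst y * snd z = fst z * snd y"
      using xy yz by (simp_all add: tqrel_def)
    have "snd y * (fst x * snd z) = (fst x * snd y) * snd z"
      by (simp only: ac_simps)
    also have "\<dots> = (fst y * snd z) * snd x"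
      unfolding 1 by (simp only: ac_simps)
    also have "\<dots> = snd y * (fst z * snd x)"
      unfolding 2 by (simp only: ac_simps)
    finally have "fst x * snd z = fst z * snd x"
      using nonzerodivisor_cancel xy unfolding tqrel_def by blast
    then show "tqrel x z"
      using xy yz by (simp add: tqrel_def)
  qed
qed

quotient_type (overloaded) 'a tquot = "'a::comm_ring_1 \<times> 'a" / partial: tqrel
  by (rule part_equivp_tqrel)

text \<open>\<open>TFrac a s\<close> is the fraction \<open>a / s\<close>; it is meaningful only for regular \<open>s\<close>, and is \<open>0\<close>
  otherwise.\<close>

lift_definition TFrac :: "'a::comm_ring_1 \<Rightarrow> 'a \<Rightarrow> 'a tquot"
  is "\<lambda>a s. if nonzerodivisor s then (a, s) else (0, 1)"
  by (simp add: tqrel_def)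

lemma TFrac_cases [cases type: tquot]:
  obtains a s where "q = TFrac a s" "nonzerodivisor s"
proof -
  have "\<exists>a s. q = TFrac a s \<and> nonzerodivisor s"
  proof (transfer)
    fix q :: "'a \<times> 'a"
    assume "tqrel q q"
    then have "nonzerodivisor (snd q)"
      by (simp add: tqrel_def)
    then show "\<exists>a s. tqrel q (if nonzerodivisor s then (a, s) else (0, 1)) \<and> nonzerodivisor s"
      by (intro exI[of _ "fst q"] exI[of _ "snd q"]) (simp add: tqrel_def)
  qed
  then show ?thesis
    using that by blast
qed

lemma TFrac_eq_iff:
  "nonzerodivisor s \<Longrightarrow> nonzerodivisor r \<Longrightarrow> TFrac a s = TFrac b r \<longleftrightarrow> a * r = b * s"
  by transfer (simp add: tqrel_def)

instantiation tquot :: (comm_ring_1) comm_ring_1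
begin

lift_definition zero_tquot :: "'a tquot" is "(0, 1)"
  by (simp add: tqrel_def)

lift_definition one_tquot :: "'a tquot" is "(1, 1)"
  by (simp add: tqrel_def)

lift_definition plus_tquot :: "'a tquot \<Rightarrow> 'a tquot \<Rightarrow> 'a tquot"
  is "\<lambda>x y. (fst x * snd y + fst y * snd x, snd x * snd y)"
proof -
  fix x x' y y' :: "'a \<times> 'a"
  assume x: "tqrel x x'" and y: "tqrel y y'"
  have "(fst x * snd y + fst y * snd x) * (snd x' * snd y')
      = (fst x * snd x') * (snd y * snd y') + (fst y * snd y') * (snd x * snd x')"
    by (simp add: algebra_simps)
  also have "\<dots> = (fst x' * snd x) * (snd y * snd y') + (fst y' * snd y) * (snd x * snd x')"
    using x y by (simp add: tqrel_def)
  also have "\<dots> = (fst x' * snd y' + fst y' * snd x') * (snd x * snd y)"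
    by (simp add: algebra_simps)
  finally show "tqrel (fst x * snd y + fst y * snd x, snd x * snd y)
      (fst x' * snd y' + fst y' * snd x', snd x' * snd y')"
    using x y by (simp add: tqrel_def)
qed

lift_definition uminus_tquot :: "'a tquot \<Rightarrow> 'a tquot"
  is "\<lambda>x. (- fst x, snd x)"
  by (auto simp: tqrel_def)

definition minus_tquot :: "'a tquot \<Rightarrow> 'a tquot \<Rightarrow> 'a tquot" where
  "minus_tquot x y = x + - y"

lift_definition times_tquot :: "'a tquot \<Rightarrow> 'a tquot \<Rightarrow> 'a tquot"
  is "\<lambda>x y. (fst x * fst y, snd x * snd y)"
proof -
  fix x x' y y' :: "'a \<times> 'a"
  assume x: "tqrel x x'" and y: "tqrel y y'"
  have "(fst x * fst y) * (snd x' * snd y') = (fst x * snd x') * (fst y * snd y')"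
    by (simp add: algebra_simps)
  also have "\<dots> = (fst x' * snd x) * (fst y' * snd y)"
    using x y by (simp add: tqrel_def)
  also have "\<dots> = (fst x' * fst y') * (snd x * snd y)"
    by (simp add: algebra_simps)
  finally show "tqrel (fst x * fst y, snd x * snd y) (fst x' * fst y', snd x' * snd y')"
    using x y by (simp add: tqrel_def)
qed

lemma zero_tquot_eq: "(0 :: 'a tquot) = TFrac 0 1"
  by transfer (simp add: tqrel_def)

lemma one_tquot_eq: "(1 :: 'a tquot) = TFrac 1 1"
  by transfer (simp add: tqrel_def)

lemma TFrac_add:
  "nonzerodivisor s \<Longrightarrow> nonzerodivisor (r :: 'a) \<Longrightarrow>
     TFrac a s + TFrac b r = TFrac (a * r + b * s) (s * r)"
  by transfer (simp add: tqrel_def)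

lemma TFrac_mult:
  "nonzerodivisor s \<Longrightarrow> nonzerodivisor (r :: 'a) \<Longrightarrow> TFrac a s * TFrac b r = TFrac (a * b) (s * r)"
  by transfer (simp add: tqrel_def)

lemma TFrac_uminus: "nonzerodivisor (s :: 'a) \<Longrightarrow> - TFrac a s = TFrac (- a) s"
  by transfer (simp add: tqrel_def)

instance
proof
  fix q r s :: "'a tquot"
  note simps = TFrac_add TFrac_mult TFrac_uminus zero_tquot_eq one_tquot_eq TFrac_eq_iff
  show "(q * r) * s = q * (r * s)"
    by (cases q, cases r, cases s) (simp add: simps mult.assoc)
  show "q * r = r * q"
    by (cases q, cases r) (simp add: simps mult.commute)
  show "1 * q = q"
    by (cases q) (simp add: simps)
  show "(q + r) + s = q + (r + s)"
    by (cases q, cases r, cases s) (simp add: simps algebra_simps)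
  show "q + r = r + q"
    by (cases q, cases r) (simp add: simps algebra_simps)
  show "0 + q = q"
    by (cases q) (simp add: simps)
  show "- q + q = 0"
    by (cases q) (simp add: simps)
  show "q - r = q + - r"
    by (rule minus_tquot_def)
  show "(q + r) * s = q * s + r * s"
    by (cases q, cases r, cases s) (simp add: simps algebra_simps)
  show "(0 :: 'a tquot) \<noteq> 1"
    by (simp add: simps)
qed

end

definition to_tquot :: "'a::comm_ring_1 \<Rightarrow> 'a tquot" where
  "to_tquot a = TFrac a 1"

lemma to_tquot_hom: "to_tquot \<in> ring_hom (ring_of UNIV) (ring_of UNIV)"
  by (rule ring_hom_memI)
     (simp_all add: to_tquot_def TFrac_add TFrac_mult one_tquot_eq)

lemma inj_to_tquot: "inj to_tquot"
  by (rule injI) (simp add: to_tquot_def TFrac_eq_iff)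

lemma to_tquot_unit: "nonzerodivisor s \<Longrightarrow> to_tquot s * TFrac 1 s = 1"
  by (simp add: to_tquot_def TFrac_mult one_tquot_eq TFrac_eq_iff)

lemma TFrac_eq: "nonzerodivisor s \<Longrightarrow> TFrac a s = to_tquot a * TFrac 1 s"
  by (simp add: to_tquot_def TFrac_mult)


section \<open>Integral closure\<close>

definition integral_over :: "'a::comm_ring_1 set \<Rightarrow> 'a \<Rightarrow> bool" where
  "integral_over A x \<longleftrightarrow>
     (\<exists>f :: 'a poly. lead_coeff f = 1 \<and> (\<forall>i. Polynomial.coeff f i \<in> A) \<and> poly f x = 0)"

definition integral_closure_in :: "'a::comm_ring_1 set \<Rightarrow> 'a set \<Rightarrow> 'a set" where
  "integral_closure_in A B = {x \<in> B. integral_over A x}"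

text \<open>For a subring \<open>A\<close> of a total quotient ring whose regular elements stay regular in the
  ambient ring (as is the case for every subring used below), \<open>total_quotients A\<close> is the total
  quotient ring of \<open>A\<close>: there, a nonzerodivisor \<open>s\<close> is invertible, so \<open>s * x = a\<close> says
  \<open>x = a / s\<close>.\<close>

definition total_quotients :: "'a::comm_ring_1 tquot set \<Rightarrow> 'a tquot set" where
  "total_quotients A = {x. \<exists>a\<in>A. \<exists>s\<in>A. nonzerodivisor s \<and> s * x = a}"

definition integral_closure :: "'a::comm_ring_1 tquot set \<Rightarrow> 'a tquot set" where
  "integral_closure A = integral_closure_in A (total_quotients A)"


section \<open>Prime ideals, localization, discrete valuation rings\<close>

definition associated_prime :: "('a, 'b) ring_scheme \<Rightarrow> 'a set \<Rightarrow> 'a set \<Rightarrow> bool" where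
  "associated_prime A J p \<longleftrightarrow>
     primeideal p A \<and> (\<exists>x\<in>carrier A. p = {a \<in> carrier A. a \<otimes>\<^bsub>A\<^esub> x \<in> J})"

definition minimal_prime :: "('a, 'b) ring_scheme \<Rightarrow> 'a set \<Rightarrow> bool" where
  "minimal_prime A z \<longleftrightarrow> primeideal z A \<and> (\<forall>z'. primeideal z' A \<and> z' \<subseteq> z \<longrightarrow> z' = z)"

definition localization_at :: "'f::field set \<Rightarrow> 'f set \<Rightarrow> 'f set" where
  "localization_at A p = {a / s | a s. a \<in> A \<and> s \<in> A - p}"

definition quotient_field :: "'f::field set \<Rightarrow> 'f set" where
  "quotient_field A = localization_at A {0}"

definition discrete_valuation_ring :: "'f::field set \<Rightarrow> bool" where
  "discrete_valuation_ring D \<longleftrightarrow>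
     principal_domain (ring_of D) \<and> \<not> Ring.field (ring_of D) \<and> (\<exists>!M. maximalideal M (ring_of D))"

text \<open>\<open>D\<close> is the discrete valuation ring \<open>(A/z)\<^bsub>(p/z)\<^esub>\<close>, for some associated prime \<open>p\<close> of the
  ideal \<open>J\<close> of \<open>A\<close> and a minimal prime \<open>z \<subseteq> p\<close>. It is realized inside a field through a
  homomorphism \<open>\<phi>\<close> defined on \<open>A\<close> with kernel \<open>z\<close>, which identifies \<open>A/z\<close> with \<open>\<phi> ` A\<close> and
  \<open>p/z\<close> with \<open>\<phi> ` p\<close>.\<close>

definition valuation_ring_through ::
  "'a::comm_ring_1 set \<Rightarrow> 'a set \<Rightarrow> ('a \<Rightarrow> 'f::field) \<Rightarrow> 'f set \<Rightarrow> bool" where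
  "valuation_ring_through A J \<phi> D \<longleftrightarrow>
     discrete_valuation_ring D \<and>
     (\<exists>p z. associated_prime (ring_of A) J p \<and> minimal_prime (ring_of A) z \<and> z \<subseteq> p \<and>
        \<phi> \<in> ring_hom (ring_of A) (ring_of UNIV) \<and>
        a_kernel (ring_of A) (ring_of UNIV) \<phi> = z \<and>
        D = localization_at (\<phi> ` A) (\<phi> ` p))"


section \<open>Rees valuation rings\<close>

text \<open>The ring \<open>A[J/b]\<close> for a regular element \<open>b\<close> of \<open>A\<close>.\<close>

definition affine_blowup :: "'a::comm_ring_1 tquot set \<Rightarrow> 'a tquot set \<Rightarrow> 'a tquot \<Rightarrow> 'a tquot set"
  where "affine_blowup A J b = generated_subring (A \<union> {x. b * x \<in> J})"

text \<open>\<open>V\<close> is the Rees valuation ring of the ideal \<open>J\<close> of \<open>A\<close> obtained from the member \<open>b\<close> of a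
  finite system of regular generators of \<open>J\<close>, realized through \<open>\<phi>\<close>.\<close>

definition rees_valuation_ring_through ::
  "'a::comm_ring_1 tquot set \<Rightarrow> 'a tquot set \<Rightarrow> 'a tquot \<Rightarrow> ('a tquot \<Rightarrow> 'f::field) \<Rightarrow> 'f set \<Rightarrow> bool"
  where
  "rees_valuation_ring_through A J b \<phi> V \<longleftrightarrow>
     (\<exists>B. finite B \<and> B \<subseteq> A \<and> (\<forall>x\<in>B. nonzerodivisor x) \<and> J = Idl\<^bsub>ring_of A\<^esub> B \<and> b \<in> B) \<and>
     (let C = integral_closure (affine_blowup A J b)
      in valuation_ring_through C (PIdl\<^bsub>ring_of C\<^esub> b) \<phi> V)"

definition rees_valuation_ring ::
  "'a::comm_ring_1 tquot set \<Rightarrow> 'a tquot set \<Rightarrow> 'f::field set \<Rightarrow> bool" where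
  "rees_valuation_ring A J V \<longleftrightarrow> (\<exists>b \<phi>. rees_valuation_ring_through A J b \<phi> V)"


section \<open>The extended Rees ring and the Itoh valuation rings\<close>

text \<open>All rings between \<open>R\<close> and \<open>R[u\<^sup>1\<^sup>/\<^sup>k, t\<^sup>1\<^sup>/\<^sup>k]\<close> are realized inside the total quotient ring of
  the polynomial ring over \<open>R\<close> in the variable \<open>u\<^sup>1\<^sup>/\<^sup>k\<close>. Thus \<open>u\<close> is the \<open>k\<close>-th power of the
  variable, and \<open>t = 1/u\<close>.\<close>

definition const_tq :: "'a::comm_ring_1 \<Rightarrow> 'a poly tquot" where
  "const_tq r = to_tquot [:r:]"

definition u_root :: "'a::comm_ring_1 poly tquot" where
  "u_root = to_tquot [:0, 1:]"

definition t_root :: "'a::comm_ring_1 poly tquot" where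
  "t_root = TFrac 1 [:0, 1:]"

lemma nonzerodivisor_X: "nonzerodivisor ([:0, 1:] :: 'a::comm_ring_1 poly)"
  by (simp add: nonzerodivisor_def)

lemma u_root_t_root: "u_root * t_root = 1"
  by (simp add: u_root_def t_root_def to_tquot_unit nonzerodivisor_X)

definition extended_rees_ring :: "nat \<Rightarrow> 'a::comm_ring_1 set \<Rightarrow> 'a poly tquot set" where
  "extended_rees_ring k I =
     generated_subring (range const_tq \<union> {u_root ^ k} \<union> (\<lambda>a. t_root ^ k * const_tq a) ` I)"

text \<open>The ring \<open>R[u, tI, u\<^sup>1\<^sup>/\<^sup>k]' \<inter> R[u\<^sup>1\<^sup>/\<^sup>k, t\<^sup>1\<^sup>/\<^sup>k]\<close>.\<close>

definition itoh_ring :: "nat \<Rightarrow> 'a::comm_ring_1 set \<Rightarrow> 'a poly tquot set" where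
  "itoh_ring k I =
     integral_closure (generated_subring (extended_rees_ring k I \<union> {u_root}))
       \<inter> generated_subring (range const_tq \<union> {u_root, t_root})"

definition itoh_valuation_ring :: "nat \<Rightarrow> 'a::comm_ring_1 set \<Rightarrow> 'f::field set \<Rightarrow> bool" where
  "itoh_valuation_ring k I U \<longleftrightarrow>
     (\<exists>\<psi>. valuation_ring_through (itoh_ring k I) (PIdl\<^bsub>ring_of (itoh_ring k I)\<^esub> u_root) \<psi> U)"


section \<open>The corresponding valuation rings over V\<close>

text \<open>For a field \<open>F\<close>, the field \<open>F(u\<^sup>1\<^sup>/\<^sup>k)\<close> is realized as the field of rational functions in the
  variable \<open>u\<^sup>1\<^sup>/\<^sup>k\<close>.\<close>

definition const_rf :: "'f::field \<Rightarrow> 'f poly fract" where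
  "const_rf c = Fract [:c:] 1"

definition u_root_rf :: "'f::field poly fract" where
  "u_root_rf = Fract [:0, 1:] 1"

text \<open>\<open>V[tc]\<^bsub>NV[tc]\<^esub>\<close> with \<open>t = 1/u\<close>. Applied to a Rees valuation ring \<open>(V, N)\<close> obtained from
  the generator \<open>b\<close> and to the image \<open>c\<close> of \<open>b\<close> in \<open>V\<close>, this is the corresponding Rees valuation
  ring of \<open>uR[u, tI]\<close>.\<close>

definition corresponding_rees :: "nat \<Rightarrow> 'f::field set \<Rightarrow> 'f set \<Rightarrow> 'f \<Rightarrow> 'f poly fract set" where
  "corresponding_rees k V N c =
     (let A = generated_subring (const_rf ` V \<union> {inverse (u_root_rf ^ k) * const_rf c})
      in localization_at A (Idl\<^bsub>ring_of A\<^esub> (const_rf ` N)))"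

text \<open>The degree \<open>[(U/P) : (W/Q)]\<close> of the residue field extension of an extension \<open>W \<subseteq> U\<close> of
  discrete valuation rings with \<open>Q = P \<inter> W\<close>; the residue field \<open>W/Q\<close> is identified with
  its image in \<open>U/P\<close>.\<close>

definition has_residue_degree :: "'f::field set \<Rightarrow> 'f set \<Rightarrow> 'f set \<Rightarrow> nat \<Rightarrow> bool" where
  "has_residue_degree U P W n \<longleftrightarrow>
     ring.dimension (ring_of U Quot P) n ((\<lambda>w. P +>\<^bsub>ring_of U\<^esub> w) ` W) (carrier (ring_of U Quot P))"

definition has_quotient_field_degree :: "'f::field set \<Rightarrow> 'f set \<Rightarrow> nat \<Rightarrow> bool" where
  "has_quotient_field_degree U W n \<longleftrightarrow>
     ring.dimension (ring_of UNIV) n (quotient_field W) (quotient_field U)"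

end

theory Submission
  imports Defs
begin

text \<open>Let \<open>v\<close> be the valuation of \<open>V\<close> and \<open>x = u\<^sup>1\<^sup>/\<^sup>k\<close>. Then \<open>bV = IV = N\<^sup>e\<close>, and
  since \<open>y = tb\<close> is a unit of \<open>W\<close>, the element \<open>x\<^sup>k = b/y\<close> has value \<open>e\<close>. With \<open>d = gcd(e, k)\<close>, \<open>k = cd\<close> and
  \<open>e = sd\<close>, consider on \<open>F(x)\<close> the monomial valuation that is \<open>c v\<close> on \<open>F\<close> and takes the value \<open>s\<close>
  at \<open>x\<close>. On \<open>F(u)\<close> it defines \<open>W\<close>, and for \<open>a\<^sub>i \<in> F(u)\<close> the value of \<open>\<Sum>\<^sub>i\<^sub><\<^sub>k a\<^sub>i x\<^sup>i\<close> is the minimum of the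
  values of the terms. Each term of a combination of nonnegative value has its \<open>k\<close>-th power in \<open>W\<close>,
  so the valuation ring is the integral closure \<open>U\<close> of \<open>W\<close>. The values on \<open>F(u)\<close> are the multiples
  of \<open>c\<close> and \<open>s\<close> is prime to \<open>c\<close>; hence \<open>NU = P\<^sup>c\<close>, and only the terms with \<open>c | i\<close> contribute to
  residues, so that the powers \<open>z\<^sup>j\<close>, \<open>j < d\<close>, of \<open>z = x\<^sup>c/\<pi>\<^sup>s\<close> form a basis of the residue field
  extension.\<close>


section \<open>Integer-valued valuations\<close>

locale int_valuation =
  fixes w :: "'k::field \<Rightarrow> int"
  assumes val_mult: "x \<noteq> 0 \<Longrightarrow> y \<noteq> 0 \<Longrightarrow> w (x * y) = w x + w y"
    and val_add: "x \<noteq> 0 \<Longrightarrow> y \<noteq> 0 \<Longrightarrow> x + y \<noteq> 0 \<Longrightarrow> min (w x) (w y) \<le> w (x + y)"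
begin

text \<open>\<open>w 0\<close> is an arbitrary integer, so this predicate carries the convention
  that 0 has infinite value; bounds on sums, which may vanish, are stated with it.\<close>

definition val_ge :: "int \<Rightarrow> 'k \<Rightarrow> bool" where
  "val_ge n x \<longleftrightarrow> x = 0 \<or> n \<le> w x"

lemma val_one [simp]: "w 1 = 0"
  using val_mult[of 1 1] by simp

lemma val_minus_one [simp]: "w (- 1) = 0"
  using val_mult[of "- 1" "- 1"] by simp

lemma val_uminus [simp]: "w (- x) = w x"
  using val_mult[of "- 1" x] by (cases "x = 0") simp_all

lemma val_inverse: "x \<noteq> 0 \<Longrightarrow> w (inverse x) = - w x"
  using val_mult[of x "inverse x"] by simp

lemma val_divide: "x \<noteq> 0 \<Longrightarrow> y \<noteq> 0 \<Longrightarrow> w (x / y) = w x - w y"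
  by (simp add: divide_inverse val_mult val_inverse)

lemma val_power: "x \<noteq> 0 \<Longrightarrow> w (x ^ n) = int n * w x"
  by (induction n) (simp_all add: val_mult algebra_simps)

lemma val_power_int: "x \<noteq> 0 \<Longrightarrow> w (x powi n) = n * w x"
  by (simp add: power_int_def val_power val_inverse)

lemma val_ge_0 [simp]: "val_ge n 0"
  by (simp add: val_ge_def)

lemma val_ge_nonzero: "x \<noteq> 0 \<Longrightarrow> val_ge n x \<longleftrightarrow> n \<le> w x"
  by (simp add: val_ge_def)

lemma val_ge_1 [simp]: "val_ge n 1 \<longleftrightarrow> n \<le> 0"
  by (simp add: val_ge_def)

lemma val_ge_mono: "val_ge n x \<Longrightarrow> m \<le> n \<Longrightarrow> val_ge m x"
  by (auto simp: val_ge_def)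

lemma val_ge_uminus [simp]: "val_ge n (- x) \<longleftrightarrow> val_ge n x"
  by (simp add: val_ge_def)

lemma val_ge_add: "val_ge n x \<Longrightarrow> val_ge n y \<Longrightarrow> val_ge n (x + y)"
  using val_add[of x y] unfolding val_ge_def
  by (cases "x = 0"; cases "y = 0"; cases "x + y = 0") auto

lemma val_ge_diff: "val_ge n x \<Longrightarrow> val_ge n y \<Longrightarrow> val_ge n (x - y)"
  using val_ge_add[of n x "- y"] by simp

lemma val_ge_sum: "(\<And>i. i \<in> T \<Longrightarrow> val_ge n (f i)) \<Longrightarrow> val_ge n (sum f T)"
  by (induction T rule: infinite_finite_induct) (auto intro: val_ge_add)

lemma val_ge_mult: "val_ge m x \<Longrightarrow> val_ge n y \<Longrightarrow> val_ge (m + n) (x * y)"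
  unfolding val_ge_def by (cases "x = 0"; cases "y = 0") (simp_all add: val_mult)

lemma val_ge_0_mult: "val_ge 0 x \<Longrightarrow> val_ge n y \<Longrightarrow> val_ge n (x * y)"
  using val_ge_mult[of 0 x n y] by simp

lemma val_ge_power: "val_ge 0 x \<Longrightarrow> val_ge 0 (x ^ n)"
  by (cases "x = 0"; cases "n = 0") (simp_all add: val_ge_def val_power)

lemma val_ge_mult_iff: "y \<noteq> 0 \<Longrightarrow> val_ge n (y * x) \<longleftrightarrow> val_ge (n - w y) x"
  unfolding val_ge_def by (cases "x = 0") (auto simp: val_mult)

lemma val_ge_all_imp_0: "(\<And>n. val_ge n x) \<Longrightarrow> x = 0"
  using val_ge_def[of "w x + 1" x] by auto

text \<open>Scaling by \<open>c\<close> makes room for values strictly between those taken on F;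
  this is how the ramification is built in before the valuation is extended.\<close>

lemma int_valuation_scale:
  assumes "0 \<le> c"
  shows "int_valuation (\<lambda>x. c * w x)"
proof
  fix x y :: 'k assume nz: "x \<noteq> 0" "y \<noteq> 0"
  then show "c * w (x * y) = c * w x + c * w y"
    by (simp add: val_mult distrib_left)
  assume "x + y \<noteq> 0"
  then have "c * min (w x) (w y) \<le> c * w (x + y)"
    using nz assms by (intro mult_left_mono val_add)
  then show "min (c * w x) (c * w y) \<le> c * w (x + y)"
    using assms by (auto simp: min_def mult_left_mono split: if_splits)
qed

end

text \<open>The extension is \<open>m\<close> of the numerator minus \<open>m\<close> of the
  denominator. Cross-multiplying two representations of a fraction and using additivity of
  \<open>m\<close> on products shows that the chosen representation does not matter.\<close>

lemma int_valuation_fract: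
  fixes m :: "'p::idom \<Rightarrow> int"
  assumes mult: "\<And>p q. p \<noteq> 0 \<Longrightarrow> q \<noteq> 0 \<Longrightarrow> m (p * q) = m p + m q"
    and add: "\<And>p q. p \<noteq> 0 \<Longrightarrow> q \<noteq> 0 \<Longrightarrow> p + q \<noteq> 0 \<Longrightarrow> min (m p) (m q) \<le> m (p + q)"
  obtains w where "int_valuation w" "\<And>p. p \<noteq> 0 \<Longrightarrow> w (Fract p 1) = m p"
proof -
  have m1: "m 1 = 0"
    using mult[of 1 1] by simp
  define num den :: "'p fract \<Rightarrow> 'p" where
    "num f = (SOME p. \<exists>q. q \<noteq> 0 \<and> f = Fract p q)" and
    "den f = (SOME q. q \<noteq> 0 \<and> f = Fract (num f) q)" for f
  have nd: "den f \<noteq> 0 \<and> f = Fract (num f) (den f)" for f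
  proof -
    have "\<exists>p q. q \<noteq> 0 \<and> f = Fract p q"
      by (cases f) auto
    then have "\<exists>q. q \<noteq> 0 \<and> f = Fract (num f) q"
      unfolding num_def by (rule someI_ex)
    then show ?thesis
      unfolding den_def by (rule someI_ex)
  qed
  define w where "w f = m (num f) - m (den f)" for f
  have w: "w (Fract p q) = m p - m q" if "p \<noteq> 0" "q \<noteq> 0" for p q
  proof -
    let ?f = "Fract p q"
    have *: "den ?f \<noteq> 0" "Fract p q = Fract (num ?f) (den ?f)"
      using nd by auto
    then have eq: "p * den ?f = num ?f * q"
      using that by (simp add: eq_fract(1))
    then have "num ?f \<noteq> 0"
      using that * by auto
    then have "m p + m (den ?f) = m (num ?f) + m q"
      using eq that * by (metis mult)
    then show ?thesis
      by (simp add: w_def)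
  qed
  have rep: "\<exists>p q. p \<noteq> 0 \<and> q \<noteq> 0 \<and> f = Fract p q" if "f \<noteq> 0" for f
    using that by (cases f) (metis fract_collapse(1))
  have "int_valuation w"
  proof
    fix f g :: "'p fract" assume "f \<noteq> 0" "g \<noteq> 0"
    then obtain p q p' q' where *: "p \<noteq> 0" "q \<noteq> 0" "f = Fract p q" "p' \<noteq> 0" "q' \<noteq> 0" "g = Fract p' q'"
      using rep by metis
    then show "w (f * g) = w f + w g"
      by (simp add: w mult)
    assume "f + g \<noteq> 0"
    moreover have fg: "f + g = Fract (p * q' + p' * q) (q * q')"
      using * by simp
    ultimately have nz: "p * q' + p' * q \<noteq> 0"
      using fract_collapse(1) by metis
    have "min (m (p * q')) (m (p' * q)) \<le> m (p * q' + p' * q)"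
      using * nz by (intro add) auto
    then show "min (w f) (w g) \<le> w (f + g)"
      unfolding fg using * nz by (simp add: w mult min_def split: if_splits)
  qed
  moreover have "w (Fract p 1) = m p" if "p \<noteq> 0" for p
    using w[of p 1] that m1 by simp
  ultimately show ?thesis
    using that by blast
qed

section \<open>Gauss valuations on polynomials\<close>

lemma finite_support_poly: "finite {i. Polynomial.coeff p i \<noteq> 0}"
  by (rule finite_subset[of _ "{..Polynomial.degree p}"]) (auto intro: le_degree)

context int_valuation
begin

text \<open>Bounds the weighted value of each monomial separately. Unlike \<open>poly_val\<close> it
  is meaningful for the zero polynomial, and sums and products are estimated through it.\<close>

definition poly_ge :: "int \<Rightarrow> int \<Rightarrow> 'k poly \<Rightarrow> bool" where
  "poly_ge s n p \<longleftrightarrow> (\<forall>i. val_ge (n - s * int i) (Polynomial.coeff p i))"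

text \<open>The Gauss valuation in which the variable has value \<open>s\<close>. At the zero
  polynomial the minimum is over the empty set and carries no information.\<close>

definition poly_val :: "int \<Rightarrow> 'k poly \<Rightarrow> int" where
  "poly_val s p = Min ((\<lambda>i. w (Polynomial.coeff p i) + s * int i) ` {i. Polynomial.coeff p i \<noteq> 0})"

lemma poly_ge_iff:
  assumes "p \<noteq> 0"
  shows "poly_ge s n p \<longleftrightarrow> n \<le> poly_val s p"
proof -
  have "{i. Polynomial.coeff p i \<noteq> 0} \<noteq> {}"
    using assms leading_coeff_neq_0 by blast
  then show ?thesis
    unfolding poly_ge_def poly_val_def val_ge_def using finite_support_poly[of p]
    by (subst Min_ge_iff) auto
qed

lemma poly_ge_mult:
  assumes "poly_ge s m p" "poly_ge s n q"
  shows "poly_ge s (m + n) (p * q)"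
  unfolding poly_ge_def
proof
  fix j
  have "val_ge (m + n - s * int j) (Polynomial.coeff p i * Polynomial.coeff q (j - i))" if "i \<le> j" for i
  proof -
    have "m + n - s * int j = (m - s * int i) + (n - s * int (j - i))"
      using that by (simp add: algebra_simps)
    then show ?thesis
      using assms val_ge_mult unfolding poly_ge_def by metis
  qed
  then show "val_ge (m + n - s * int j) (Polynomial.coeff (p * q) j)"
    unfolding coeff_mult by (intro val_ge_sum) auto
qed

text \<open>Gauss's lemma: the coefficient of \<open>p * q\<close> at the sum of the least indices at which \<open>p\<close> and
  \<open>q\<close> attain their values cannot cancel.\<close>

lemma poly_val_mult:
  assumes p: "p \<noteq> 0" and q: "q \<noteq> 0"
  shows "poly_val s (p * q) = poly_val s p + poly_val s q"
proof (rule order_antisym)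
  let ?c = Polynomial.coeff
  have least: "\<exists>i. ?c r i \<noteq> 0 \<and> w (?c r i) + s * int i = poly_val s r \<and>
      (\<forall>l<i. val_ge (poly_val s r + 1 - s * int l) (?c r l))" if "r \<noteq> 0" for r
  proof -
    let ?P = "\<lambda>i. ?c r i \<noteq> 0 \<and> w (?c r i) + s * int i = poly_val s r"
    have "poly_val s r \<in> (\<lambda>i. w (?c r i) + s * int i) ` {i. ?c r i \<noteq> 0}"
      unfolding poly_val_def using that leading_coeff_neq_0[of r]
      by (intro Min_in finite_imageI finite_support_poly) blast
    then have "\<exists>i. ?P i"
      by auto
    then have P: "?P (LEAST i. ?P i)"
      by (rule LeastI_ex)
    have "val_ge (poly_val s r + 1 - s * int l) (?c r l)" if "l < (LEAST i. ?P i)" for l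
    proof -
      have "\<not> ?P l"
        using not_less_Least[OF that] .
      moreover have "val_ge (poly_val s r - s * int l) (?c r l)"
        using poly_ge_iff[OF \<open>r \<noteq> 0\<close>, of s "poly_val s r"] unfolding poly_ge_def by blast
      ultimately show ?thesis
        by (auto simp: val_ge_def)
    qed
    then show ?thesis
      using P by blast
  qed
  obtain i where i: "?c p i \<noteq> 0" "w (?c p i) + s * int i = poly_val s p"
    "\<And>l. l < i \<Longrightarrow> val_ge (poly_val s p + 1 - s * int l) (?c p l)"
    using least[OF p] by blast
  obtain j where j: "?c q j \<noteq> 0" "w (?c q j) + s * int j = poly_val s q"
    "\<And>l. l < j \<Longrightarrow> val_ge (poly_val s q + 1 - s * int l) (?c q l)"
    using least[OF q] by blast
  have pge: "val_ge (poly_val s p - s * int l) (?c p l)" for l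
    using poly_ge_iff[OF p, of s "poly_val s p"] unfolding poly_ge_def by blast
  have qge: "val_ge (poly_val s q - s * int l) (?c q l)" for l
    using poly_ge_iff[OF q, of s "poly_val s q"] unfolding poly_ge_def by blast
  \<comment> \<open>\<open>?M\<close> is one more than the value that the product of the two
    extremal coefficients has. Every other product reaches it: an index other than \<open>i\<close>
    puts either \<open>l\<close> below \<open>i\<close> or \<open>i + j - l\<close> below
    \<open>j\<close>, where the values are strictly larger.\<close>
  let ?M = "poly_val s p + poly_val s q + 1 - s * int (i + j)"
  have rest: "val_ge ?M (?c p l * ?c q (i + j - l))" if "l \<in> {..i + j} - {i}" for l
  proof (cases "l < i")
    case True
    have "?M = (poly_val s p + 1 - s * int l) + (poly_val s q - s * int (i + j - l))"
      using that by (simp add: algebra_simps)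
    then show ?thesis
      using val_ge_mult[OF i(3)[OF True] qge] by metis
  next
    case False
    then have lt: "i + j - l < j"
      using that by auto
    have "?M = (poly_val s p - s * int l) + (poly_val s q + 1 - s * int (i + j - l))"
      using that by (simp add: algebra_simps)
    then show ?thesis
      using val_ge_mult[OF pge j(3)[OF lt]] by metis
  qed
  have "?c (p * q) (i + j) = ?c p i * ?c q j + (\<Sum>l\<in>{..i + j} - {i}. ?c p l * ?c q (i + j - l))"
    unfolding coeff_mult by (subst sum.remove[of _ i]) auto
  moreover have "\<not> val_ge ?M (?c p i * ?c q j)"
    using i j by (simp add: val_ge_def val_mult algebra_simps)
  moreover have "val_ge ?M (\<Sum>l\<in>{..i + j} - {i}. ?c p l * ?c q (i + j - l))"
    by (intro val_ge_sum rest)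
  ultimately have "\<not> val_ge ?M (?c (p * q) (i + j))"
    using val_ge_diff by fastforce
  then have "\<not> poly_ge s (poly_val s p + poly_val s q + 1) (p * q)"
    unfolding poly_ge_def by blast
  then show "poly_val s (p * q) \<le> poly_val s p + poly_val s q"
    using p q by (subst (asm) poly_ge_iff) auto
  show "poly_val s p + poly_val s q \<le> poly_val s (p * q)"
    using p q poly_ge_mult[of s "poly_val s p" p "poly_val s q" q]
    by (simp add: poly_ge_iff)
qed

lemma poly_val_add:
  assumes "p \<noteq> 0" "q \<noteq> 0" "p + q \<noteq> 0"
  shows "min (poly_val s p) (poly_val s q) \<le> poly_val s (p + q)"
proof -
  have "poly_ge s (min (poly_val s p) (poly_val s q)) p" "poly_ge s (min (poly_val s p) (poly_val s q)) q"
    using assms by (simp_all add: poly_ge_iff)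
  then have "poly_ge s (min (poly_val s p) (poly_val s q)) (p + q)"
    unfolding poly_ge_def by (simp add: val_ge_add)
  then show ?thesis
    using assms by (simp add: poly_ge_iff)
qed

end

section \<open>Monomial valuations on rational functions\<close>

lemma const_rf_simps [simp]:
  "const_rf 0 = 0" "const_rf 1 = 1"
  "const_rf (a + b) = const_rf a + const_rf b"
  "const_rf (a * b) = const_rf a * const_rf b"
  "const_rf (- a) = - const_rf a"
  by (simp_all add: const_rf_def fract_collapse mult.commute[of b] flip: one_pCons)

lemma const_rf_eq_0_iff [simp]: "const_rf a = 0 \<longleftrightarrow> a = 0"
  by (simp add: const_rf_def Zero_fract_def eq_fract)

lemma const_rf_inverse [simp]: "const_rf (inverse a) = inverse (const_rf a)"
proof (cases "a = 0")
  case False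
  then have "const_rf a * const_rf (inverse a) = 1"
    by (simp flip: const_rf_simps(4))
  then show ?thesis
    by (simp add: inverse_unique)
qed simp

lemma const_rf_power [simp]: "const_rf (a ^ n) = const_rf a ^ n"
  by (induction n) simp_all

lemma const_rf_sum: "const_rf (sum f T) = (\<Sum>i\<in>T. const_rf (f i))"
  by (induction T rule: infinite_finite_induct) simp_all

lemma u_root_rf_nonzero [simp]: "u_root_rf \<noteq> 0"
  by (simp add: u_root_rf_def Zero_fract_def eq_fract)

lemma Fract_1_sum: "Fract (sum f T) 1 = (\<Sum>i\<in>T. Fract (f i) (1 :: 'p::idom))"
proof (induction T rule: infinite_finite_induct)
  case (insert i T)
  have "Fract (f i + sum f T) 1 = Fract (f i) 1 + Fract (sum f T) (1 :: 'p)"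
    by simp
  with insert show ?case
    by simp
qed (simp_all add: fract_collapse)

lemma u_root_rf_power: "u_root_rf ^ n = Fract (Polynomial.monom 1 n) 1"
  by (induction n) (simp_all add: u_root_rf_def monom_altdef fract_collapse flip: one_pCons)

lemma Fract_monom: "Fract (Polynomial.monom a n) 1 = const_rf a * u_root_rf ^ n"
  by (simp add: u_root_rf_power const_rf_def smult_monom)

lemma Fract_poly: "Fract p 1 = (\<Sum>i\<le>Polynomial.degree p. const_rf (Polynomial.coeff p i) * u_root_rf ^ i)"
  by (subst poly_as_sum_of_monoms[of p, symmetric]) (simp add: Fract_1_sum Fract_monom)

text \<open>The last condition is what makes the valuation monomial: a bound on a Laurent polynomial
  in x passes to each of its terms. Negative exponents occur because t = 1/u will be
  involved.\<close>

locale monomial_valuation = base: int_valuation v + int_valuation w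
  for v :: "'f::field \<Rightarrow> int" and w :: "'f poly fract \<Rightarrow> int" +
  fixes c s :: int
  assumes val_const: "\<And>a. a \<noteq> 0 \<Longrightarrow> w (const_rf a) = c * v a"
    and val_u_root: "w u_root_rf = s"
    and val_ge_laurent: "\<And>T m a n. finite T \<Longrightarrow>
      val_ge m (\<Sum>n\<in>T. const_rf (a n) * u_root_rf powi n) \<Longrightarrow>
      n \<in> T \<Longrightarrow> val_ge m (const_rf (a n) * u_root_rf powi n)"

text \<open>The witness is the Gauss valuation of \<open>c * v\<close> with weight \<open>s\<close>,
  extended to fractions. A Laurent polynomial is multiplied by a power of x to become a polynomial,
  for which bounds are coefficientwise by \<open>ge\<close>.\<close>

lemma monomial_valuation_exists:
  fixes v :: "'f::field \<Rightarrow> int"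
  assumes v: "int_valuation v" and c: "0 \<le> c"
  obtains w where "monomial_valuation v w c s"
proof -
  define v' where "v' = (\<lambda>x. c * v x)"
  interpret v: int_valuation v by (rule v)
  interpret v': int_valuation v'
    unfolding v'_def by (rule v.int_valuation_scale[OF c])
  obtain w where w: "int_valuation w" and wp: "\<And>p. p \<noteq> 0 \<Longrightarrow> w (Fract p 1) = v'.poly_val s p"
    using int_valuation_fract[of "v'.poly_val s"] v'.poly_val_mult v'.poly_val_add by metis
  interpret w: int_valuation w by (rule w)
  have ge: "w.val_ge m (Fract p 1) \<longleftrightarrow> v'.poly_ge s m p" for m p
  proof (cases "p = 0")
    case True
    then show ?thesis
      by (simp add: fract_collapse v'.poly_ge_def)
  next
    case False
    then have "Fract p 1 \<noteq> 0"
      by (simp add: Zero_fract_def eq_fract)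
    with False show ?thesis
      by (simp add: w.val_ge_nonzero v'.poly_ge_iff wp)
  qed
  have wm: "w (const_rf a * u_root_rf ^ n) = v' a + s * int n" if "a \<noteq> 0" for a n
  proof (rule order_antisym)
    have nz: "const_rf a * u_root_rf ^ n \<noteq> 0"
      using that by simp
    have "w.val_ge m (const_rf a * u_root_rf ^ n) \<longleftrightarrow> m \<le> v' a + s * int n" for m
      unfolding ge Fract_monom[symmetric] v'.poly_ge_def using that
      by (auto simp: v'.val_ge_def)
    then show "w (const_rf a * u_root_rf ^ n) \<le> v' a + s * int n"
      "v' a + s * int n \<le> w (const_rf a * u_root_rf ^ n)"
      using nz by (auto simp: w.val_ge_nonzero)
  qed
  have w1: "w (const_rf a) = v' a" if "a \<noteq> 0" for a
    using wm[OF that, of 0] by simp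
  have wx: "w u_root_rf = s"
    using wm[of 1 1] by simp
  have "monomial_valuation v w c s"
  proof (intro monomial_valuation.intro monomial_valuation_axioms.intro v w)
    show "w (const_rf a) = c * v a" if "a \<noteq> 0" for a
      using w1[OF that] by (simp add: v'_def)
    show "w u_root_rf = s"
      by (rule wx)
    fix T :: "int set" and m a n
    assume T: "finite T" "w.val_ge m (\<Sum>n\<in>T. const_rf (a n) * u_root_rf powi n)" "n \<in> T"
    let ?t = "\<lambda>n. const_rf (a n) * u_root_rf powi n"
    \<comment> \<open>Truncation at 0 is harmless: if all exponents are nonnegative no shift is
      required, and otherwise the shift is exactly minus the least exponent.\<close>
    define M where "M = nat (- Min T)"
    have M: "0 \<le> n + int M" if "n \<in> T" for n
      using Min_le[OF T(1) that] by (simp add: M_def)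
    define p where "p = (\<Sum>n\<in>T. Polynomial.monom (a n) (nat (n + int M)))"
    have shift: "u_root_rf ^ M * ?t n = const_rf (a n) * u_root_rf ^ nat (n + int M)" if "n \<in> T" for n
    proof -
      have "u_root_rf ^ M * ?t n = const_rf (a n) * (u_root_rf powi n * u_root_rf powi int M)"
        by simp
      also have "\<dots> = const_rf (a n) * u_root_rf powi (n + int M)"
        by (subst power_int_add) auto
      also have "n + int M = int (nat (n + int M))"
        using M[OF that] by simp
      finally show ?thesis
        by (metis power_int_of_nat)
    qed
    have "u_root_rf ^ M * (\<Sum>n\<in>T. ?t n) = Fract p 1"
      unfolding p_def Fract_1_sum Fract_monom sum_distrib_left by (rule sum.cong) (simp_all add: shift)
    moreover have "w.val_ge (m + int M * s) (u_root_rf ^ M * (\<Sum>n\<in>T. ?t n))"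
      using T(2) by (subst w.val_ge_mult_iff) (simp_all add: w.val_power wx)
    ultimately have "v'.poly_ge s (m + int M * s) p"
      using ge by simp
    then have "v'.val_ge (m + int M * s - s * int (nat (n + int M))) (Polynomial.coeff p (nat (n + int M)))"
      unfolding v'.poly_ge_def by blast
    \<comment> \<open>All shifted exponents are nonnegative, so \<open>nat\<close> keeps distinct
      exponents distinct and only the summand \<open>i = n\<close> survives.\<close>
    moreover have "Polynomial.coeff p (nat (n + int M)) = (\<Sum>i\<in>T. if i = n then a i else 0)"
      unfolding p_def coeff_sum using M M[OF T(3)] by (intro sum.cong) (auto simp: nat_eq_iff)
    then have "Polynomial.coeff p (nat (n + int M)) = a n"
      using T(1,3) by simp
    ultimately have "v'.val_ge (m + int M * s - s * int (nat (n + int M))) (a n)"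
      by simp
    then have "v'.val_ge (m - s * n) (a n)"
      using M[OF T(3)] by (simp add: algebra_simps)
    then show "w.val_ge m (?t n)"
      by (cases "a n = 0")
        (auto simp: w.val_ge_def v'.val_ge_def w.val_mult w1 w.val_power_int wx algebra_simps)
  qed
  then show ?thesis
    using that by blast
qed

section \<open>Orthogonality over the subfield generated by the k-th power\<close>

text \<open>Modulo \<open>q\<close> polynomials form a space of dimension deg q, so the residues of
  the deg q + 1 powers 1, x^k, x^(2k), ... satisfy a linear relation, whose coefficients form
  \<open>r\<close>. The resulting multiple of \<open>q\<close> is a polynomial in x^k and later
  moves denominators into F(u).\<close>

lemma pow_multiples_dependent_mod:
  fixes q :: "'f::field poly"
  assumes q: "q \<noteq> 0"
  obtains r h where "r \<noteq> 0" "pcompose r (Polynomial.monom 1 k) = q * h"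
proof -
  interpret vs: vector_space "smult :: 'f \<Rightarrow> 'f poly \<Rightarrow> 'f poly"
    by unfold_locales (simp_all add: smult_add_left smult_add_right)
  let ?n = "Polynomial.degree q"
  define f where "f j = Polynomial.monom 1 (k * j) mod q" for j
  have "\<exists>r. r \<noteq> 0 \<and> (\<Sum>j\<le>Polynomial.degree r. smult (Polynomial.coeff r j) (f j)) = 0"
  proof (cases "inj_on f {..?n}")
    \<comment> \<open>Linear dependence is a property of sets and does not see repetitions, so two
      equal residues are treated separately; their difference is already a relation.\<close>
    case False
    then obtain i j where ij: "i < j" "f i = f j"
      unfolding inj_on_def by (metis linorder_neqE_nat)
    define r :: "'f poly" where "r = - Polynomial.monom 1 i + Polynomial.monom 1 j"
    have r: "Polynomial.coeff r l = (if l = j then 1 else 0) - (if l = i then 1 else 0)" for l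
      by (auto simp: r_def)
    have "Polynomial.degree r = j"
      unfolding r_def by (subst degree_add_eq_right) (use ij in \<open>auto simp: Polynomial.degree_monom_eq\<close>)
    then have "(\<Sum>l\<le>Polynomial.degree r. smult (Polynomial.coeff r l) (f l))
        = (\<Sum>l\<le>j. (if l = j then f l else 0) - (if l = i then f l else 0))"
      by (intro sum.cong) (auto simp: r)
    also have "\<dots> = 0"
      using ij by (simp add: sum_subtractf)
    finally show ?thesis
      using r[of j] ij(1) by (intro exI[of _ r]) auto
  next
    case True
    have "vs.dependent (f ` {..?n})"
    proof (rule ccontr)
      assume indep: "vs.independent (f ` {..?n})"
      let ?B = "Polynomial.monom (1 :: 'f) ` {..<?n}"
      have "f ` {..?n} \<subseteq> vs.span ?B"
      proof
        fix p assume "p \<in> f ` {..?n}"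
        then have p: "p = 0 \<or> Polynomial.degree p < ?n"
          using degree_mod_less[OF q] by (auto simp: f_def)
        have "p = (\<Sum>i\<le>Polynomial.degree p. smult (Polynomial.coeff p i) (Polynomial.monom 1 i))"
          using poly_as_sum_of_monoms[of p] by (simp add: smult_monom)
        also have "\<dots> \<in> vs.span ?B"
        proof (cases "p = 0")
          case False
          with p show ?thesis
            by (intro vs.span_sum vs.span_scale vs.span_base) auto
        qed (simp add: vs.span_zero)
        finally show "p \<in> vs.span ?B" .
      qed
      then have "card (f ` {..?n}) \<le> card ?B"
        using vs.independent_span_bound[OF _ indep] by blast
      also have "\<dots> \<le> ?n"
        using card_image_le[of "{..<?n}" "Polynomial.monom (1 :: 'f)"] by simp
      finally show False
        using card_image[OF True] by simp
    qed
    then obtain u v where u: "v \<in> f ` {..?n}" "u v \<noteq> 0" "(\<Sum>v\<in>f ` {..?n}. smult (u v) v) = 0"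
      by (subst (asm) vs.dependent_finite) auto
    define r where "r = (\<Sum>j\<le>?n. Polynomial.monom (u (f j)) j)"
    have r: "Polynomial.coeff r j = (if j \<le> ?n then u (f j) else 0)" for j
      unfolding r_def coeff_sum by simp
    have "Polynomial.degree r \<le> ?n"
      by (rule degree_le) (simp add: r)
    then have "(\<Sum>j\<le>Polynomial.degree r. smult (Polynomial.coeff r j) (f j))
        = (\<Sum>j\<le>?n. smult (Polynomial.coeff r j) (f j))"
      by (intro sum.mono_neutral_left) (auto simp: coeff_eq_0)
    also have "\<dots> = (\<Sum>j\<le>?n. smult (u (f j)) (f j))"
      by (intro sum.cong) (auto simp: r)
    also have "\<dots> = 0"
      using u(3) sum.reindex[OF True, of "\<lambda>v. smult (u v) v"] by simp
    finally show ?thesis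
      using u(1,2) r by (intro exI[of _ r]) (metis (no_types, lifting) Polynomial.coeff_0 atMost_iff imageE)
  qed
  then obtain r where r: "r \<noteq> 0" "(\<Sum>j\<le>Polynomial.degree r. smult (Polynomial.coeff r j) (f j)) = 0"
    by blast
  have "pcompose r (Polynomial.monom 1 k)
      = (\<Sum>j\<le>Polynomial.degree r. smult (Polynomial.coeff r j) (Polynomial.monom 1 (k * j)))"
    by (simp add: pcompose_altdef poly_altdef coeff_map_poly degree_map_poly monom_power)
  also have "\<dots> = (\<Sum>j\<le>Polynomial.degree r. q * smult (Polynomial.coeff r j) (Polynomial.monom 1 (k * j) div q)
      + smult (Polynomial.coeff r j) (f j))"
    unfolding f_def mult_smult_right smult_add_right[symmetric] mult_div_mod_eq by (rule refl)
  also have "\<dots> = q * (\<Sum>j\<le>Polynomial.degree r. smult (Polynomial.coeff r j) (Polynomial.monom 1 (k * j) div q))"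
    by (simp only: sum.distrib r(2) sum_distrib_left add_0_right)
  finally show ?thesis
    using that r(1) by blast
qed

lemma map_poly_const_rf_simps:
  "map_poly const_rf (p + q) = map_poly const_rf p + map_poly const_rf q"
  "map_poly const_rf (p * q) = map_poly const_rf p * map_poly const_rf q"
  by (rule poly_eqI, simp add: coeff_map_poly coeff_mult const_rf_sum)+

text \<open>Here \<open>g\<close> stands for the image of b. The equation \<open>ks_eq\<close> says
  that x^k and \<open>g\<close> have the same value, so that tg has value 0.\<close>

locale kummer_monomial = monomial_valuation v w c s
  for v :: "'f::field \<Rightarrow> int" and w c s +
  fixes k :: nat and g :: 'f
  assumes k_pos: "0 < k" and g_nonzero: "g \<noteq> 0" and c_pos: "0 < c"
    and ks_eq: "int k * s = c * v g"
begin

definition y :: "'f poly fract" where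
  "y = inverse (u_root_rf ^ k) * const_rf g"

definition ev :: "'f poly \<Rightarrow> 'f poly fract" where
  "ev p = poly (map_poly const_rf p) y"

text \<open>This is the field \<open>F(u)\<close>, since \<open>u = g / y\<close>.\<close>

definition subfield_L :: "'f poly fract set" where
  "subfield_L = {ev p / ev q | p q. q \<noteq> 0}"

lemma y_nonzero: "y \<noteq> 0"
  by (simp add: y_def g_nonzero)

lemma val_y: "w y = 0"
  using ks_eq by (simp add: y_def val_mult val_inverse val_power g_nonzero val_const val_u_root)

lemma ev_simps [simp]:
  "ev 0 = 0" "ev 1 = 1" "ev (p + q) = ev p + ev q" "ev (p * q) = ev p * ev q"
  "ev [:a:] = const_rf a" "ev [:0, 1:] = y"
  by (simp_all add: ev_def map_poly_const_rf_simps map_poly_pCons)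

lemma ev_altdef: "ev p = (\<Sum>l\<le>Polynomial.degree p. const_rf (Polynomial.coeff p l) * y ^ l)"
  by (simp add: ev_def poly_altdef coeff_map_poly degree_map_poly)

lemma y_power_u_root: "y ^ l = const_rf (g ^ l) * u_root_rf powi - int (k * l)"
  by (simp add: y_def power_mult_distrib power_inverse power_int_minus power_int_of_nat mult.commute
      del: of_nat_mult flip: power_mult)

lemma val_ge_const_mult_y: "val_ge m (const_rf a * y ^ l * x) \<longleftrightarrow> val_ge m (const_rf a * x)"
  using val_ge_mult_iff[of "y ^ l" m "const_rf a * x"] y_nonzero val_y
  by (simp add: val_power mult_ac)

text \<open>Expanding in powers of \<open>y\<close> gives Laurent monomials x^(i - kl). For i < k
  the exponent determines i, its residue mod k, and then l; so no two terms merge and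
  \<open>val_ge_laurent\<close> applies. The powers of \<open>y\<close> have value 0 and drop out of
  the bounds.\<close>

lemma val_ge_ev_sum_iff:
  assumes I: "finite I" "I \<subseteq> {..<k}"
  shows "val_ge m (\<Sum>i\<in>I. ev (p i) * u_root_rf ^ i) \<longleftrightarrow>
    (\<forall>i\<in>I. \<forall>l. val_ge m (const_rf (Polynomial.coeff (p i) l) * u_root_rf ^ i))"
proof -
  let ?T = "SIGMA i:I. {..Polynomial.degree (p i)}"
  let ?n = "\<lambda>(i, l). int i - int (k * l)"
  \<comment> \<open>Decodes an exponent n = i - kl into the pair (i, l), since
    \<open>val_ge_laurent\<close> takes coefficients indexed by exponents. The factor
    \<open>g ^ l\<close> comes from \<open>y ^ l\<close>.\<close>
  define a where "a n = (let i = nat (n mod int k); l = nat ((int i - n) div int k)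
    in Polynomial.coeff (p i) l * g ^ l)" for n
  have a: "a (?n (i, l)) = Polynomial.coeff (p i) l * g ^ l" if "i < k" for i l
  proof -
    have "(int i - int (k * l)) mod int k = int i"
      using that by (simp add: mod_diff_eq[symmetric])
    then show ?thesis
      using k_pos by (simp add: a_def)
  qed
  have inj: "inj_on ?n ?T"
  proof (rule inj_onI, clarify)
    fix i l i' l'
    assume *: "i \<in> I" "i' \<in> I" "int i - int (k * l) = int i' - int (k * l')"
    have "(int j - int (k * l)) mod int k = int j" if "j \<in> I" for j l
      using that I(2) by (auto simp: mod_diff_eq[symmetric])
    then have "i = i'"
      using * by (metis of_nat_eq_iff)
    then show "i = i' \<and> l = l'"
      using *(3) k_pos by simp
  qed
  have trm: "const_rf (Polynomial.coeff (p i) l) * y ^ l * u_root_rf ^ i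
      = const_rf (a (?n (i, l))) * u_root_rf powi ?n (i, l)" if "i < k" for i l
  proof -
    have "u_root_rf powi (- int (k * l) + int i)
        = u_root_rf powi - int (k * l) * (u_root_rf :: 'f poly fract) powi int i"
      by (rule power_int_add) simp
    then show ?thesis
      using a[OF that, of l] by (simp add: y_power_u_root mult_ac)
  qed
  have sum: "(\<Sum>i\<in>I. ev (p i) * u_root_rf ^ i)
      = (\<Sum>n\<in>?n ` ?T. const_rf (a n) * u_root_rf powi n)"
  proof -
    have "(\<Sum>i\<in>I. ev (p i) * u_root_rf ^ i)
        = (\<Sum>(i, l)\<in>?T. const_rf (Polynomial.coeff (p i) l) * y ^ l * u_root_rf ^ i)"
      unfolding ev_altdef sum_distrib_right using I(1) by (subst sum.Sigma) auto
    also have "\<dots> = (\<Sum>t\<in>?T. const_rf (a (?n t)) * u_root_rf powi ?n t)"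
      using I(2) by (intro sum.cong) (auto simp: trm simp del: split_paired_All)
    finally show ?thesis
      by (subst sum.reindex[OF inj]) (simp add: o_def)
  qed
  show ?thesis
  proof
    assume *: "val_ge m (\<Sum>i\<in>I. ev (p i) * u_root_rf ^ i)"
    show "\<forall>i\<in>I. \<forall>l. val_ge m (const_rf (Polynomial.coeff (p i) l) * u_root_rf ^ i)"
    proof (intro ballI allI)
      fix i l assume i: "i \<in> I"
      show "val_ge m (const_rf (Polynomial.coeff (p i) l) * u_root_rf ^ i)"
      proof (cases "l \<le> Polynomial.degree (p i)")
        case True
        have "?n (i, l) \<in> ?n ` ?T"
          using True i by (intro imageI) auto
        then have "val_ge m (const_rf (a (?n (i, l))) * u_root_rf powi ?n (i, l))"
          using * I(1) unfolding sum by (intro val_ge_laurent[of "?n ` ?T" m a]) auto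
        then have "val_ge m (const_rf (Polynomial.coeff (p i) l) * y ^ l * u_root_rf ^ i)"
          using trm[of i l] i I(2) by auto
        then show ?thesis
          by (simp only: val_ge_const_mult_y)
      qed (simp add: coeff_eq_0)
    qed
  next
    assume "\<forall>i\<in>I. \<forall>l. val_ge m (const_rf (Polynomial.coeff (p i) l) * u_root_rf ^ i)"
    then show "val_ge m (\<Sum>i\<in>I. ev (p i) * u_root_rf ^ i)"
      unfolding ev_altdef sum_distrib_right
      by (intro val_ge_sum) (simp add: val_ge_const_mult_y)
  qed
qed

lemma val_ge_ev_u_root_iff:
  "i < k \<Longrightarrow> val_ge m (ev p * u_root_rf ^ i) \<longleftrightarrow>
    (\<forall>l. val_ge m (const_rf (Polynomial.coeff p l) * u_root_rf ^ i))"
  using val_ge_ev_sum_iff[of "{i}" m "\<lambda>_. p"] by simp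

lemma val_ge_ev_iff: "val_ge m (ev p) \<longleftrightarrow> (\<forall>l. val_ge m (const_rf (Polynomial.coeff p l)))"
  using val_ge_ev_u_root_iff[of 0 m p] k_pos by simp

text \<open>Transcendence of \<open>y\<close> over F: 0 satisfies every bound, hence so does each
  coefficient.\<close>

lemma ev_eq_0_iff [simp]: "ev p = 0 \<longleftrightarrow> p = 0"
proof
  assume "ev p = 0"
  then have "val_ge m (const_rf (Polynomial.coeff p l))" for m l
    using val_ge_ev_iff[of m p] by simp
  then have "const_rf (Polynomial.coeff p l) = 0" for l
    by (rule val_ge_all_imp_0)
  then show "p = 0"
    by (simp add: poly_eq_iff)
qed simp

text \<open>The bound \<open>w (ev p)\<close> holds for all coefficients and the next larger bound
  fails for some coefficient, which therefore attains the value.\<close>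

lemma val_ev:
  assumes "p \<noteq> 0"
  obtains l where "Polynomial.coeff p l \<noteq> 0" "w (ev p) = c * v (Polynomial.coeff p l)"
proof -
  have "val_ge (w (ev p)) (ev p)" "\<not> val_ge (w (ev p) + 1) (ev p)"
    using assms by (simp_all add: val_ge_nonzero)
  then obtain l where "val_ge (w (ev p)) (const_rf (Polynomial.coeff p l))"
    "\<not> val_ge (w (ev p) + 1) (const_rf (Polynomial.coeff p l))"
    unfolding val_ge_ev_iff by blast
  then show ?thesis
    using that by (auto simp: val_ge_def val_const)
qed

lemma subfield_LE:
  assumes "f \<in> subfield_L"
  obtains p q where "q \<noteq> 0" "f = ev p / ev q"
  using assms unfolding subfield_L_def by blast

lemma subfield_LI: "q \<noteq> 0 \<Longrightarrow> f = ev p / ev q \<Longrightarrow> f \<in> subfield_L"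
  unfolding subfield_L_def by blast

lemma ev_in_L: "ev p \<in> subfield_L"
  by (rule subfield_LI[of 1 _ p]) simp_all

lemma L_closed [simp]:
  "0 \<in> subfield_L" "1 \<in> subfield_L" "const_rf a \<in> subfield_L" "y \<in> subfield_L"
  using ev_in_L[of 0] ev_in_L[of 1] ev_in_L[of "[:a:]"] ev_in_L[of "[:0, 1:]"] by simp_all

lemma L_mult [intro]: "a \<in> subfield_L \<Longrightarrow> b \<in> subfield_L \<Longrightarrow> a * b \<in> subfield_L"
proof (elim subfield_LE)
  fix p q p' q' assume "q \<noteq> 0" "a = ev p / ev q" "q' \<noteq> 0" "b = ev p' / ev q'"
  then show "a * b \<in> subfield_L"
    by (intro subfield_LI[of "q * q'" _ "p * p'"]) simp_all
qed

lemma L_add [intro]: "a \<in> subfield_L \<Longrightarrow> b \<in> subfield_L \<Longrightarrow> a + b \<in> subfield_L"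
proof (elim subfield_LE)
  fix p q p' q' assume "q \<noteq> 0" "a = ev p / ev q" "q' \<noteq> 0" "b = ev p' / ev q'"
  then show "a + b \<in> subfield_L"
    by (intro subfield_LI[of "q * q'" _ "p * q' + p' * q"]) (simp_all add: add_frac_eq)
qed

lemma L_inverse [intro]: "a \<in> subfield_L \<Longrightarrow> inverse a \<in> subfield_L"
proof (elim subfield_LE)
  fix p q assume "q \<noteq> 0" "a = ev p / ev q"
  then show "inverse a \<in> subfield_L"
    by (cases "p = 0") (auto intro: subfield_LI[of p _ q])
qed

lemma L_uminus [intro]: "a \<in> subfield_L \<Longrightarrow> - a \<in> subfield_L"
  using L_mult[OF L_closed(3)[of "- 1"], of a] by simp

lemma L_divide [intro]: "a \<in> subfield_L \<Longrightarrow> b \<in> subfield_L \<Longrightarrow> a / b \<in> subfield_L"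
  by (auto simp: divide_inverse)

lemma L_power [intro]: "a \<in> subfield_L \<Longrightarrow> a ^ n \<in> subfield_L"
  by (induction n) auto

lemma L_sum [intro]: "(\<And>i. i \<in> T \<Longrightarrow> f i \<in> subfield_L) \<Longrightarrow> sum f T \<in> subfield_L"
  by (induction T rule: infinite_finite_induct) auto

lemma u_root_power_k: "u_root_rf ^ k = const_rf g / y"
  by (simp add: y_def g_nonzero field_simps)

lemma u_root_power_k_in_L: "u_root_rf ^ k \<in> subfield_L"
  unfolding u_root_power_k by auto

lemma common_denominator:
  assumes "finite T" "\<And>i. i \<in> T \<Longrightarrow> a i \<in> subfield_L"
  shows "\<exists>q p. q \<noteq> 0 \<and> (\<forall>i\<in>T. a i = ev (p i) / ev q)"
  using assms
proof (induction T)
  case empty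
  then show ?case
    by (intro exI[of _ 1]) simp
next
  case (insert j T)
  then obtain q p where qp: "q \<noteq> 0" "\<forall>i\<in>T. a i = ev (p i) / ev q"
    by auto
  obtain q' p' where qp': "q' \<noteq> 0" "a j = ev p' / ev q'"
    using insert.prems subfield_LE by blast
  have "\<forall>i\<in>insert j T. a i = ev (((\<lambda>i. p i * q')(j := p' * q)) i) / ev (q * q')"
    using qp qp' insert.hyps by auto
  then show ?case
    using qp(1) qp'(1) by (intro exI[of _ "q * q'"] exI[of _ "(\<lambda>i. p i * q')(j := p' * q)"]) simp
qed

text \<open>Clearing a common denominator shifts all values by the same amount and reduces the claim
  to polynomials in \<open>y\<close>.\<close>

lemma val_ge_L_combination:
  assumes a: "\<And>i. i < k \<Longrightarrow> a i \<in> subfield_L"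
    and ge: "val_ge m (\<Sum>i<k. a i * u_root_rf ^ i)" and i: "i < k"
  shows "val_ge m (a i * u_root_rf ^ i)"
proof -
  obtain q p where q: "q \<noteq> 0" and p: "\<And>i. i < k \<Longrightarrow> a i = ev (p i) / ev q"
    using common_denominator[of "{..<k}" a] a by auto
  have "ev q * (\<Sum>i<k. a i * u_root_rf ^ i) = (\<Sum>i<k. ev (p i) * u_root_rf ^ i)"
    unfolding sum_distrib_left using q by (intro sum.cong) (auto simp: p)
  moreover have "val_ge (m + w (ev q)) (ev q * (\<Sum>i<k. a i * u_root_rf ^ i))"
    using ge q by (simp add: val_ge_mult_iff)
  ultimately have "val_ge (m + w (ev q)) (\<Sum>i<k. ev (p i) * u_root_rf ^ i)"
    by simp
  then have "val_ge (m + w (ev q)) (ev (p i) * u_root_rf ^ i)"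
    using i by (simp add: val_ge_ev_sum_iff val_ge_ev_u_root_iff)
  also have "ev (p i) * u_root_rf ^ i = ev q * (a i * u_root_rf ^ i)"
    using p[OF i] q by simp
  finally show ?thesis
    using q by (simp add: val_ge_mult_iff)
qed

text \<open>Numerator and denominator each have the value of one of their coefficients, and these
  lie in F, where \<open>w\<close> is \<open>c * v\<close>.\<close>

lemma val_L:
  assumes "f \<in> subfield_L" "f \<noteq> 0"
  shows "c dvd w f"
proof -
  obtain p q where pq: "q \<noteq> 0" "f = ev p / ev q"
    using assms(1) by (rule subfield_LE)
  then have "p \<noteq> 0"
    using assms(2) by auto
  then obtain l l' where "w (ev p) = c * v (Polynomial.coeff p l)" "w (ev q) = c * v (Polynomial.coeff q l')"
    using pq(1) val_ev by metis
  then show ?thesis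
    using pq \<open>p \<noteq> 0\<close> by (simp add: val_divide)
qed

text \<open>The combinations form an F(u)-module \<open>E\<close> containing the powers of x, hence
  all polynomials. A fraction p/q is expanded by the cofactor \<open>h\<close> that turns its
  denominator into a polynomial in x^k, an element of F(u).\<close>

lemma L_combination_exists:
  "\<exists>a. (\<forall>i<k. a i \<in> subfield_L) \<and> f = (\<Sum>i<k. a i * u_root_rf ^ i)"
proof -
  define E where "E = {\<Sum>i<k. a i * u_root_rf ^ i | a. \<forall>i<k. a i \<in> subfield_L}"
  have E_add: "f + h \<in> E" if fh: "f \<in> E" "h \<in> E" for f h
  proof -
    obtain a b where "f = (\<Sum>i<k. a i * u_root_rf ^ i)" "\<forall>i<k. a i \<in> subfield_L"
      "h = (\<Sum>i<k. b i * u_root_rf ^ i)" "\<forall>i<k. b i \<in> subfield_L"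
      using fh unfolding E_def by blast
    then show ?thesis
      unfolding E_def by (auto intro!: exI[of _ "\<lambda>i. a i + b i"] simp: distrib_right sum.distrib)
  qed
  have E_mult: "l * f \<in> E" if lf: "l \<in> subfield_L" "f \<in> E" for l f
  proof -
    obtain a where "f = (\<Sum>i<k. a i * u_root_rf ^ i)" "\<forall>i<k. a i \<in> subfield_L"
      using lf(2) unfolding E_def by blast
    then show ?thesis
      using lf(1) unfolding E_def
      by (auto intro!: exI[of _ "\<lambda>i. l * a i"] simp: sum_distrib_left mult.assoc)
  qed
  have E_0: "0 \<in> E"
    unfolding E_def by (auto intro!: exI[of _ "\<lambda>_. 0"])
  have E_sum: "sum h T \<in> E" if "\<And>i. i \<in> T \<Longrightarrow> h i \<in> E" for h :: "nat \<Rightarrow> _" and T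
    using that by (induction T rule: infinite_finite_induct) (auto intro: E_0 E_add)
  have E_pow: "u_root_rf ^ n \<in> E" for n
  proof -
    have "u_root_rf ^ n = (u_root_rf ^ k) ^ (n div k) * u_root_rf ^ (n mod k)"
      by (simp flip: power_mult power_add)
    moreover have "u_root_rf ^ (n mod k) \<in> E"
      using k_pos unfolding E_def
      by (auto intro!: exI[of _ "\<lambda>i. if i = n mod k then 1 else 0"] simp: if_distrib[of "\<lambda>x. x * _"] cong: if_cong)
    ultimately show ?thesis
      using E_mult L_power u_root_power_k_in_L by metis
  qed
  have E_poly: "Fract p 1 \<in> E" for p
    unfolding Fract_poly by (intro E_sum E_mult E_pow L_closed)
  obtain p q where q: "q \<noteq> 0" and f: "f = Fract p q"
    by (cases f) auto
  obtain r h where r: "r \<noteq> 0" "pcompose r (Polynomial.monom 1 k) = q * h"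
    using pow_multiples_dependent_mod[OF q] by blast
  have "pcompose r (Polynomial.monom 1 k) \<noteq> 0"
    using r(1) k_pos by (simp add: pcompose_eq_0_iff Polynomial.degree_monom_eq)
  then have h: "h \<noteq> 0" "q * h \<noteq> 0"
    using r(2) by auto
  have "Fract (q * h) 1 = (\<Sum>j\<le>Polynomial.degree r. const_rf (Polynomial.coeff r j) * (u_root_rf ^ k) ^ j)"
    unfolding r(2)[symmetric] pcompose_altdef poly_altdef Fract_1_sum
    by (simp add: degree_map_poly coeff_map_poly monom_power smult_monom Fract_monom flip: power_mult)
  also have "\<dots> \<in> subfield_L"
    by (intro L_sum L_mult L_closed L_power u_root_power_k_in_L)
  finally have "inverse (Fract (q * h) 1) \<in> subfield_L"
    by (rule L_inverse)
  then have "inverse (Fract (q * h) 1) * Fract (p * h) 1 \<in> E"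
    using E_mult E_poly by blast
  also have "inverse (Fract (q * h) 1) * Fract (p * h) 1 = f"
    using q h by (simp add: f eq_fract)
  finally show ?thesis
    unfolding E_def by blast
qed

end

section \<open>Subrings of a field in HOL-Algebra\<close>

lemma cring_ring_ofI:
  assumes "1 \<in> A" "\<And>x y. x \<in> A \<Longrightarrow> y \<in> A \<Longrightarrow> x + y \<in> A"
    "\<And>x y. x \<in> A \<Longrightarrow> y \<in> A \<Longrightarrow> x * y \<in> A" "\<And>x. x \<in> A \<Longrightarrow> - x \<in> A"
  shows "cring (ring_of A)"
proof (rule cringI)
  have "0 \<in> A"
    using assms(2)[OF assms(1) assms(4)[OF assms(1)]] by simp
  then show "abelian_group (ring_of A)"
    using assms by (intro abelian_groupI) (auto simp: algebra_simps intro: bexI[of _ "- x" for x])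
  show "comm_monoid (ring_of A)"
    using assms by (intro comm_monoidI) (auto simp: algebra_simps)
qed (auto simp: algebra_simps)

lemma a_inv_ring_of:
  assumes "cring (ring_of A)" "x \<in> A"
  shows "\<ominus>\<^bsub>ring_of A\<^esub> x = - x"
proof -
  interpret cring "ring_of A" by fact
  have "x + \<ominus>\<^bsub>ring_of A\<^esub> x = 0"
    using r_neg[of x] assms(2) by simp
  then show ?thesis
    by (simp add: add_eq_0_iff)
qed

lemma ring_of_closed:
  assumes "cring (ring_of A)"
  shows "0 \<in> A" "1 \<in> A" "\<And>x y. x \<in> A \<Longrightarrow> y \<in> A \<Longrightarrow> x + y \<in> A"
    "\<And>x y. x \<in> A \<Longrightarrow> y \<in> A \<Longrightarrow> x * y \<in> A" "\<And>x. x \<in> A \<Longrightarrow> - x \<in> A"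
    "\<And>x y. x \<in> A \<Longrightarrow> y \<in> A \<Longrightarrow> x - y \<in> A" "\<And>x n. x \<in> A \<Longrightarrow> x ^ n \<in> A"
    "\<And>f T. (\<And>i. i \<in> T \<Longrightarrow> f i \<in> A) \<Longrightarrow> sum f T \<in> A"
proof -
  interpret cring "ring_of A" by fact
  show 0: "0 \<in> A" and 1: "1 \<in> A"
    using zero_closed one_closed by simp_all
  show add: "x + y \<in> A" if "x \<in> A" "y \<in> A" for x y
    using a_closed[of x y] that by simp
  show mult: "x * y \<in> A" if "x \<in> A" "y \<in> A" for x y
    using m_closed[of x y] that by simp
  show uminus: "- x \<in> A" if "x \<in> A" for x
    using a_inv_closed[of x] a_inv_ring_of[OF assms that] that by simp
  show "x - y \<in> A" if "x \<in> A" "y \<in> A" for x y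
    using add[OF that(1) uminus[OF that(2)]] by simp
  show "x ^ n \<in> A" if "x \<in> A" for x n
    using that by (induction n) (auto intro: 1 mult)
  show "sum f T \<in> A" if "\<And>i. i \<in> T \<Longrightarrow> f i \<in> A" for f and T :: "'b set"
    using that by (induction T rule: infinite_finite_induct) (auto intro: 0 add)
qed

lemma nat_pow_ring_of: "x [^]\<^bsub>ring_of A\<^esub> (n :: nat) = x ^ n"
  by (induction n) (simp_all add: nat_pow_def mult.commute)

lemma PIdl_ring_of: "PIdl\<^bsub>ring_of A\<^esub> a = {x * a | x. x \<in> A}"
  by (simp add: cgenideal_def)

lemma ideal_ring_ofI:
  assumes A: "cring (ring_of A)" and "J \<subseteq> A" "0 \<in> J"
    and add: "\<And>x y. x \<in> J \<Longrightarrow> y \<in> J \<Longrightarrow> x + y \<in> J"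
    and mult: "\<And>a x. a \<in> A \<Longrightarrow> x \<in> J \<Longrightarrow> a * x \<in> J"
  shows "ideal J (ring_of A)"
proof (rule idealI)
  interpret cring "ring_of A" by fact
  show "ring (ring_of A)" ..
  show "subgroup J (add_monoid (ring_of A))"
  proof (rule add.subgroupI)
    fix a assume "a \<in> J"
    moreover have "- 1 \<in> A"
      using ring_of_closed[OF A] by blast
    ultimately show "\<ominus>\<^bsub>ring_of A\<^esub> a \<in> J"
      using a_inv_ring_of[OF A] mult[of "- 1" a] \<open>J \<subseteq> A\<close> by auto
  qed (use assms in auto)
  fix a x assume "a \<in> J" "x \<in> carrier (ring_of A)"
  then show "x \<otimes>\<^bsub>ring_of A\<^esub> a \<in> J" "a \<otimes>\<^bsub>ring_of A\<^esub> x \<in> J"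
    using mult[of x a] by (simp_all add: mult.commute)
qed

lemma ideal_ring_ofD:
  assumes "ideal J (ring_of A)"
  shows "J \<subseteq> A" "0 \<in> J" "\<And>x y. x \<in> J \<Longrightarrow> y \<in> J \<Longrightarrow> x + y \<in> J"
    "\<And>a x. a \<in> A \<Longrightarrow> x \<in> J \<Longrightarrow> a * x \<in> J"
proof -
  interpret ideal J "ring_of A" by fact
  show "J \<subseteq> A" "0 \<in> J"
    using a_subset additive_subgroup.zero_closed[OF is_additive_subgroup] by simp_all
  show "x + y \<in> J" if "x \<in> J" "y \<in> J" for x y
    using additive_subgroup.a_closed[OF is_additive_subgroup, of x y] that by simp
  show "a * x \<in> J" if "a \<in> A" "x \<in> J" for a x
    using I_l_closed[of x a] that by simp
qed

lemma (in cring) ideal_prod_cgenideal: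
  assumes a: "a \<in> carrier R" and b: "b \<in> carrier R"
  shows "(PIdl a) \<cdot> (PIdl b) = PIdl (a \<otimes> b)"
proof (rule equalityI)
  have I: "ideal (PIdl (a \<otimes> b)) R"
    by (rule cgenideal_ideal[OF m_closed[OF a b]])
  show "(PIdl a) \<cdot> (PIdl b) \<subseteq> PIdl (a \<otimes> b)"
  proof
    fix x assume "x \<in> (PIdl a) \<cdot> (PIdl b)"
    then show "x \<in> PIdl (a \<otimes> b)"
    proof induction
      case (prod i j)
      then obtain r s where "r \<in> carrier R" "s \<in> carrier R" "i = r \<otimes> a" "j = s \<otimes> b"
        by (auto simp: cgenideal_def)
      moreover from this have "i \<otimes> j = (r \<otimes> s) \<otimes> (a \<otimes> b)"
        using a b by (simp add: m_ac)
      ultimately show ?case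
        unfolding cgenideal_def by blast
    next
      case (sum s1 s2)
      then show ?case
        using additive_subgroup.a_closed[OF ideal.axioms(1)[OF I]] by blast
    qed
  qed
  show "PIdl (a \<otimes> b) \<subseteq> (PIdl a) \<cdot> (PIdl b)"
    by (rule cgenideal_minimal[OF ideal_prod_is_ideal[OF cgenideal_ideal[OF a] cgenideal_ideal[OF b]]
          ideal_prod.prod[OF cgenideal_self[OF a] cgenideal_self[OF b]]])
qed

lemma (in cring) ideals_set_pow_cgenideal:
  assumes "a \<in> carrier R"
  shows "(PIdl a) [^]\<^bsub>ideals_set R\<^esub> (n :: nat) = PIdl (a [^] n)"
proof (induction n)
  case 0
  have "PIdl \<one> = carrier R"
    by (auto simp: cgenideal_def) (metis r_one)
  then show ?case
    by (simp add: nat_pow_def ideals_set_def)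
next
  case (Suc n)
  have "(PIdl a) [^]\<^bsub>ideals_set R\<^esub> Suc n = ((PIdl a) [^]\<^bsub>ideals_set R\<^esub> n) \<cdot> (PIdl a)"
    by (simp add: nat_pow_def ideals_set_def)
  then show ?case
    using assms Suc by (simp add: ideal_prod_cgenideal)
qed

text \<open>Under \<open>h\<close>, each \<open>b j\<close> avoids the span of its predecessors, so
  the span grows by one line extension per step, as in the inductive definition of dimension. The
  map \<open>h\<close> is kept general: it is the identity for the field degree and the residue map
  for the residue degree.\<close>

lemma dimension_image_combinations:
  fixes A :: "'k::comm_ring_1 set" and b :: "nat \<Rightarrow> 'k"
  assumes A: "cring (ring_of A)" and S: "ring S" and h: "h \<in> ring_hom (ring_of A) S"
    and K: "K \<subseteq> A" and b: "\<And>i. i < n \<Longrightarrow> b i \<in> A"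
    and indep: "\<And>j a. j < n \<Longrightarrow> (\<And>i. i < j \<Longrightarrow> a i \<in> K) \<Longrightarrow> h (b j) \<noteq> h (\<Sum>i<j. a i * b i)"
  shows "ring.dimension S n (h ` K) (h ` {\<Sum>i<n. a i * b i | a. \<forall>i<n. a i \<in> K})"
proof -
  interpret S: ring S by fact
  interpret A: cring "ring_of A" by fact
  interpret h: ring_hom_ring "ring_of A" S h
    by (rule ring_hom_ringI2[OF A.ring_axioms S h])
  define E where "E m = {\<Sum>i<m. a i * b i | a. \<forall>i<m. a i \<in> K}" for m
  have comb: "(\<Sum>i<m. a i * b i) \<in> A" if "m \<le> n" "\<forall>i<m. a i \<in> K" for m a
    using that K b by (intro ring_of_closed[OF A]) auto
  have "S.dimension m (h ` K) (h ` E m)" if "m \<le> n" for m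
    using that
  proof (induction m)
    case 0
    have "h ` E 0 = {\<zero>\<^bsub>S\<^esub>}"
      using h.hom_zero by (simp add: E_def)
    then show ?case
      by simp
  next
    case (Suc m)
    have E_sub: "E m \<subseteq> A"
      using comb[of m] Suc.prems by (auto simp: E_def)
    have E_Suc: "E (Suc m) = {l * b m + x | l x. l \<in> K \<and> x \<in> E m}"
    proof (intro equalityI subsetI)
      fix x assume "x \<in> E (Suc m)"
      then obtain a where "x = (\<Sum>i<Suc m. a i * b i)" "\<forall>i<Suc m. a i \<in> K"
        unfolding E_def by blast
      then show "x \<in> {l * b m + x | l x. l \<in> K \<and> x \<in> E m}"
        unfolding E_def
        by (intro CollectI exI[of _ "a m"] exI[of _ "\<Sum>i<m. a i * b i"]) (auto simp: add.commute)
    next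
      fix x assume "x \<in> {l * b m + x | l x. l \<in> K \<and> x \<in> E m}"
      then obtain l a where "l \<in> K" "x = l * b m + (\<Sum>i<m. a i * b i)" "\<forall>i<m. a i \<in> K"
        unfolding E_def by blast
      then show "x \<in> E (Suc m)"
        unfolding E_def
        by (intro CollectI exI[of _ "a(m := l)"]) (auto simp: add.commute less_Suc_eq)
    qed
    have "S.dimension (Suc m) (h ` K) (S.line_extension (h ` K) (h (b m)) (h ` E m))"
    proof (rule S.Suc_dim)
      show "h (b m) \<in> carrier S"
        using b[of m] Suc.prems by simp
      show "h (b m) \<notin> h ` E m"
        using indep[of m] Suc.prems by (auto simp: E_def)
      show "S.dimension m (h ` K) (h ` E m)"
        using Suc by simp
    qed
    also have "S.line_extension (h ` K) (h (b m)) (h ` E m) = h ` E (Suc m)"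
    proof -
      have "h (l * b m + x) = h l \<otimes>\<^bsub>S\<^esub> h (b m) \<oplus>\<^bsub>S\<^esub> h x" if "l \<in> K" "x \<in> E m" for l x
      proof -
        have "l \<in> A" "x \<in> A" "b m \<in> A" "l * b m \<in> A"
          using that K E_sub b[of m] Suc.prems ring_of_closed(4)[OF A, of l "b m"] by auto
        then show ?thesis
          using h.hom_add[of "l * b m" x] h.hom_mult[of l "b m"] by simp
      qed
      then have "h ` E (Suc m) = {h l \<otimes>\<^bsub>S\<^esub> h (b m) \<oplus>\<^bsub>S\<^esub> h x | l x. l \<in> K \<and> x \<in> E m}"
        unfolding E_Suc by force
      also have "\<dots> = S.line_extension (h ` K) (h (b m)) (h ` E m)"
        unfolding Set.set_eq_iff S.line_extension_mem_iff by blast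
      finally show ?thesis ..
    qed
    finally show ?case .
  qed
  from this[of n] show ?thesis
    by (simp add: E_def)
qed

section \<open>Valuation rings in subfields and their maximal ideals\<close>

context int_valuation
begin

text \<open>\<open>L\<close> stays a parameter: the whole field gives U and V, the subfield F(u)
  gives W.\<close>

lemma cring_val_ring:
  assumes "cring (ring_of L)"
  shows "cring (ring_of {x \<in> L. val_ge 0 x})"
  using ring_of_closed[OF assms] by (intro cring_ring_ofI) (auto intro: val_ge_add val_ge_0_mult)

lemma ideal_val_ge:
  assumes "cring (ring_of L)" "0 \<le> n"
  shows "ideal {x \<in> L. val_ge n x} (ring_of {x \<in> L. val_ge 0 x})"
  using ring_of_closed(1,3,4)[OF assms(1)] val_ge_mono[OF _ assms(2)]
  by (intro ideal_ring_ofI cring_val_ring assms) (auto intro: val_ge_add val_ge_0_mult)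

text \<open>An element of value 0 has its inverse in the ring, so \<open>M\<close> contains none and
  lies in the ideal of positive values. That ideal is proper, and maximality forces
  equality.\<close>

lemma maximalideal_val_ring:
  assumes L: "cring (ring_of L)" and inv: "\<And>x. x \<in> L \<Longrightarrow> inverse x \<in> L"
    and M: "maximalideal M (ring_of {x \<in> L. val_ge 0 x})"
  shows "M = {x \<in> L. val_ge 1 x}"
proof -
  let ?A = "{x \<in> L. val_ge 0 x}" and ?J = "{x \<in> L. val_ge 1 x}"
  interpret maximalideal M "ring_of ?A" by fact
  note MD = ideal_ring_ofD[OF is_ideal]
  have "M \<subseteq> ?J"
  proof
    fix x assume x: "x \<in> M"
    then have xA: "x \<in> L" "val_ge 0 x"
      using MD(1) by auto
    show "x \<in> ?J"
    proof (rule ccontr)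
      assume "x \<notin> ?J"
      then have x0: "x \<noteq> 0" "w x = 0"
        using xA by (auto simp: val_ge_def)
      then have inv_x: "inverse x \<in> ?A"
        using xA inv by (auto simp: val_ge_def val_inverse)
      have "a \<in> M" if a: "a \<in> ?A" for a
      proof -
        have "a * inverse x \<in> ?A"
          using a inv_x ring_of_closed(4)[OF cring_val_ring[OF L]] by blast
        then have "a * inverse x * x \<in> M"
          using x by (rule MD(4))
        then show ?thesis
          using x0(1) by (simp add: mult.assoc)
      qed
      then show False
        using MD(1) I_notcarr by auto
    qed
  qed
  moreover have "ideal ?J (ring_of ?A)"
    using ideal_val_ge[OF L] by simp
  moreover have "?J \<subseteq> ?A"
    using val_ge_mono[of 1 _ 0] by auto
  moreover have "1 \<in> ?A" "1 \<notin> ?J"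
    using ring_of_closed(2)[OF L] by simp_all
  then have "?J \<noteq> ?A"
    by blast
  ultimately show ?thesis
    using I_maximal[of ?J] by auto
qed

end

text \<open>With \<pi> a generator of \<open>N\<close>, every nonzero element of F is a unit of V
  times a unique power of \<pi>; the exponent is the valuation.\<close>

lemma dvr_valuation:
  assumes V: "discrete_valuation_ring (V :: 'f::field set)" and F: "quotient_field V = UNIV"
    and N: "maximalideal N (ring_of V)"
  obtains v \<pi> where "int_valuation v" "V = {x. int_valuation.val_ge v 0 x}"
    "N = {x. int_valuation.val_ge v 1 x}" "\<pi> \<noteq> 0" "v \<pi> = 1"
proof -
  interpret V: principal_domain "ring_of V"
    using V by (simp add: discrete_valuation_ring_def)
  note cr = V.cring_axioms
  note closed = ring_of_closed[OF cr]
  interpret N: maximalideal N "ring_of V" by fact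
  obtain \<pi> where \<pi>: "\<pi> \<in> V" "N = PIdl\<^bsub>ring_of V\<^esub> \<pi>"
    using V.exists_gen[OF N.is_ideal] by auto
  then have N_eq: "N = {x * \<pi> | x. x \<in> V}"
    by (simp add: PIdl_ring_of)
  have \<pi>0: "\<pi> \<noteq> 0"
  proof
    assume "\<pi> = 0"
    then have "N = {\<zero>\<^bsub>ring_of V\<^esub>}"
      using closed(1) by (auto simp: N_eq)
    then have "Ring.field (ring_of V)"
      using V.zeromaximalideal_fieldI N by simp
    then show False
      using V by (simp add: discrete_valuation_ring_def)
  qed
  have \<pi>_nonunit: "inverse \<pi> \<notin> V"
  proof
    assume "inverse \<pi> \<in> V"
    then have "x \<in> N" if "x \<in> V" for x
      using that \<pi>0 closed(4)[of x "inverse \<pi>"] by (auto simp: N_eq intro!: exI[of _ "x * inverse \<pi>"])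
    then show False
      using N.I_notcarr N.a_subset by auto
  qed
  \<comment> \<open>A nonunit has an irreducible divisor, which generates a maximal ideal. As
    \<open>N\<close> is the only one, the element would lie in \<open>N\<close>.\<close>
  have unit: "inverse x \<in> V" if x: "x \<in> V" "x \<notin> N" "x \<noteq> 0" for x
  proof (rule ccontr)
    assume "inverse x \<notin> V"
    then have "x \<notin> Units (ring_of V)"
      using x by (auto simp: Units_def) (metis inverse_unique mult.commute)
    then obtain p where p: "p \<in> V" "ring_irreducible\<^bsub>ring_of V\<^esub> p" "p divides\<^bsub>ring_of V\<^esub> x"
      using V.exists_irreducible_divisor[of x] x by (metis Diff_iff ring_of_simps(1,4) singletonD)
    then have "maximalideal (PIdl\<^bsub>ring_of V\<^esub> p) (ring_of V)"
      using V.irreducible_imp_maximalideal by simp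
    then have "PIdl\<^bsub>ring_of V\<^esub> p = N"
      using V N unfolding discrete_valuation_ring_def by blast
    moreover have "x \<in> PIdl\<^bsub>ring_of V\<^esub> p"
      using p(3) by (auto simp: factor_def PIdl_ring_of mult.commute)
    ultimately show False
      using x by simp
  qed
  have fin: "\<exists>n. \<not> (\<exists>r\<in>V. x = r * \<pi> ^ n)" if x: "x \<in> V" "x \<noteq> 0" for x
  proof -
    \<comment> \<open>The intersection of all \<pi>^n V. It is principal, and a nonzero generator
      could be divided by \<pi> inside \<open>J\<close>, which would make \<pi> a unit; so it is
      zero.\<close>
    define J where "J = {x \<in> V. \<forall>n. \<exists>r\<in>V. x = r * \<pi> ^ n}"
    have "ideal J (ring_of V)"
    proof (rule ideal_ring_ofI[OF cr])
      show "J \<subseteq> V" "0 \<in> J"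
        by (auto simp: J_def closed(1) intro: bexI[of _ 0])
      show "x + y \<in> J" if "x \<in> J" "y \<in> J" for x y
        using that closed(3) unfolding J_def by clarsimp (metis distrib_right)
      show "a * x \<in> J" if "a \<in> V" "x \<in> J" for a x
        using that closed(4) unfolding J_def by clarsimp (metis mult.assoc)
    qed
    then obtain q where q: "q \<in> V" "J = PIdl\<^bsub>ring_of V\<^esub> q"
      using V.exists_gen by auto
    have "q = 0"
    proof (rule ccontr)
      assume "q \<noteq> 0"
      have qJ: "q \<in> J"
        using q closed(2) by (auto simp: PIdl_ring_of intro!: exI[of _ 1])
      then obtain h where h: "h \<in> V" "q = h * \<pi> ^ 1"
        unfolding J_def by blast
      have "\<exists>r\<in>V. h = r * \<pi> ^ n" for n
      proof -
        obtain r where "r \<in> V" "q = r * \<pi> ^ Suc n"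
          using qJ unfolding J_def by blast
        then show ?thesis
          using h \<pi>0 by (intro bexI[of _ r]) auto
      qed
      then have "h \<in> J"
        using h by (simp add: J_def)
      then obtain t where "t \<in> V" "h = t * q"
        using q by (auto simp: PIdl_ring_of)
      moreover have "t * \<pi> = 1"
        using calculation h \<open>q \<noteq> 0\<close> by auto
      ultimately show False
        using \<pi>_nonunit \<pi>0 by (metis inverse_unique mult.commute)
    qed
    then have "x \<notin> J"
      using q x by (auto simp: PIdl_ring_of)
    then show ?thesis
      using x by (simp add: J_def)
  qed
  have \<pi>_powi: "\<pi> powi n \<in> V" if "0 \<le> n" for n
    using that closed(7)[OF \<pi>(1)] by (simp add: power_int_def)
  define unit where "unit r \<longleftrightarrow> r \<noteq> 0 \<and> r \<in> V \<and> inverse r \<in> V" for r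
  have unit_mult: "unit (r * s)" "unit (inverse r)" if "unit r" "unit s" for r s
    using that closed(4) by (auto simp: unit_def)
  have repV: "\<exists>r n. unit r \<and> x = r * \<pi> powi int n" if x: "x \<in> V" "x \<noteq> 0" for x
  proof -
    \<comment> \<open>The first power of \<pi> that does not divide \<open>x\<close>. It is not the
      zeroth, and the power before it leaves a cofactor outside \<open>N\<close>, hence a
      unit.\<close>
    define n where "n = (LEAST n. \<not> (\<exists>r\<in>V. x = r * \<pi> ^ n))"
    have n: "\<not> (\<exists>r\<in>V. x = r * \<pi> ^ n)"
      unfolding n_def by (rule LeastI_ex[OF fin[OF x]])
    then have "n \<noteq> 0"
      using x by (metis mult.right_neutral power_0)
    then obtain m where m: "n = Suc m"
      by (cases n) auto
    then have "\<exists>r\<in>V. x = r * \<pi> ^ m"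
      using not_less_Least[of m "\<lambda>n. \<not> (\<exists>r\<in>V. x = r * \<pi> ^ n)"] unfolding n_def by auto
    then obtain r where r: "r \<in> V" "x = r * \<pi> ^ m"
      by blast
    have "r \<notin> N"
      using n r by (auto simp: N_eq m mult.assoc)
    then have "unit r"
      using r x \<open>\<And>x. x \<in> V \<Longrightarrow> x \<notin> N \<Longrightarrow> x \<noteq> 0 \<Longrightarrow> inverse x \<in> V\<close> by (auto simp: unit_def)
    then show ?thesis
      using r by auto
  qed
  have rep: "\<exists>n. \<exists>r. unit r \<and> x = r * \<pi> powi n" if "x \<noteq> 0" for x
  proof -
    have "x \<in> quotient_field V"
      using F by simp
    then obtain a b where ab: "x = a / b" "a \<in> V" "b \<in> V" "b \<noteq> 0"
      by (auto simp: quotient_field_def localization_at_def)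
    then have "a \<noteq> 0"
      using that by auto
    with ab obtain r m s n where "unit r" "a = r * \<pi> powi int m" "unit s" "b = s * \<pi> powi int n"
      using repV by metis
    then have "unit (r * inverse s)"
      using unit_mult by blast
    moreover have "x = r * inverse s * \<pi> powi (int m - int n)"
      using \<pi>0 ab(1) \<open>a = _\<close> \<open>b = _\<close> \<open>unit s\<close> by (simp add: unit_def power_int_diff divide_inverse)
    ultimately show ?thesis
      by blast
  qed
  \<comment> \<open>If m > n, cancelling leaves a positive power of \<pi> equal to a unit, so \<pi>
    would be a unit.\<close>
  have uniq: "m = n" if "unit r" "unit s" "r * \<pi> powi m = s * \<pi> powi n" for r s m n
  proof -
    have "m \<le> n" if "unit r" "unit s" "r * \<pi> powi m = s * \<pi> powi n" for r s m n
    proof (rule ccontr)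
      assume "\<not> m \<le> n"
      have "r * \<pi> powi (m - n) = s"
        using that \<pi>0 by (simp add: power_int_diff field_simps)
      moreover have "\<pi> powi (m - n) = \<pi> powi (m - n - 1) * \<pi>"
        using \<pi>0 by (simp add: power_int_diff)
      ultimately have "inverse s * (r * \<pi> powi (m - n - 1)) * \<pi> = 1"
        using that by (auto simp: unit_def mult.assoc)
      then have "inverse \<pi> = inverse s * (r * \<pi> powi (m - n - 1))"
        using inverse_unique[of \<pi>] by (simp add: mult.commute)
      moreover have "inverse s * (r * \<pi> powi (m - n - 1)) \<in> V"
        using that \<open>\<not> m \<le> n\<close> by (intro closed(4) \<pi>_powi) (auto simp: unit_def)
      ultimately show False
        using \<pi>_nonunit by simp
    qed
    then show ?thesis
      using that by (metis order_antisym)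
  qed
  define v where "v x = (THE n. \<exists>r. unit r \<and> x = r * \<pi> powi n)" for x
  have v: "v (r * \<pi> powi n) = n" if "unit r" for r n
    unfolding v_def using that uniq by (intro the_equality) metis+
  have V_iff: "r * \<pi> powi n \<in> V \<longleftrightarrow> 0 \<le> n" if r: "unit r" for r n
  proof
    assume "r * \<pi> powi n \<in> V"
    moreover have "r * \<pi> powi n \<noteq> 0"
      using r \<pi>0 by (simp add: unit_def)
    ultimately obtain s m where "unit s" "r * \<pi> powi n = s * \<pi> powi int m"
      using repV by blast
    then show "0 \<le> n"
      using uniq r by fastforce
  next
    assume "0 \<le> n"
    then show "r * \<pi> powi n \<in> V"
      using r by (intro closed(4) \<pi>_powi) (auto simp: unit_def)
  qed
  have v_mem: "x \<in> V \<longleftrightarrow> 0 \<le> v x" if "x \<noteq> 0" for x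
    using rep[OF that] V_iff v by metis
  have v_mult: "v (x * y) = v x + v y" if xy: "x \<noteq> 0" "y \<noteq> 0" for x y
  proof -
    obtain r m s n where *: "unit r" "x = r * \<pi> powi m" "unit s" "y = s * \<pi> powi n"
      using rep xy by metis
    have "x * y = (r * s) * \<pi> powi (m + n)"
      using * \<pi>0 by (simp add: power_int_add)
    then show ?thesis
      using * v unit_mult(1) by metis
  qed
  \<comment> \<open>Dividing by the element of smaller value reduces the inequality to closure of V
    under addition: x + y = x (1 + y/x), and y/x lies in V.\<close>
  have v_add: "v x \<le> v (x + y)" if xy: "x \<noteq> 0" "y \<noteq> 0" "x + y \<noteq> 0" "v x \<le> v y" for x y
  proof -
    have "v (y * inverse x) = v y + v (inverse x)" "v (x * inverse x) = v x + v (inverse x)"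
      using xy v_mult[of y "inverse x"] v_mult[of x "inverse x"] by simp_all
    moreover have "v (x * inverse x) = 0"
      using v[of 1 0] closed(2) xy(1) by (simp add: unit_def)
    ultimately have "y * inverse x \<in> V"
      using v_mem[of "y * inverse x"] xy by simp
    then have "1 + y * inverse x \<in> V"
      by (rule closed(3)[OF closed(2)])
    moreover have eq: "x + y = x * (1 + y * inverse x)"
      using xy by (simp add: field_simps)
    moreover have nz: "1 + y * inverse x \<noteq> 0"
      using eq xy(3) by auto
    ultimately show ?thesis
      using v_mult[OF xy(1) nz] v_mem[OF nz] by simp
  qed
  have val: "int_valuation v"
  proof
    show "min (v x) (v y) \<le> v (x + y)" if "x \<noteq> 0" "y \<noteq> 0" "x + y \<noteq> 0" for x y
      using v_add[of x y] v_add[of y x] that by (cases "v x \<le> v y") (auto simp: add.commute)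
  qed (rule v_mult)
  interpret v: int_valuation v by (rule val)
  have v\<pi>: "v \<pi> = 1"
    using v[of 1 1] closed(2) by (simp add: unit_def)
  have V_eq: "V = {x \<in> UNIV. v.val_ge 0 x}"
  proof (rule Set.set_eqI)
    fix x
    show "x \<in> V \<longleftrightarrow> x \<in> {x \<in> UNIV. v.val_ge 0 x}"
      using v_mem[of x] closed(1) by (cases "x = 0") (simp_all add: v.val_ge_def)
  qed
  then have "maximalideal N (ring_of {x \<in> UNIV. v.val_ge 0 x})"
    using N by simp
  then have "N = {x \<in> UNIV. v.val_ge 1 x}"
    by (rule v.maximalideal_val_ring[OF cring_ring_of_UNIV, rotated]) simp
  then show ?thesis
    using that[of v \<pi>] val V_eq \<pi>0 v\<pi> by simp
qed

section \<open>The Rees valuation ring and its integral closure\<close>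

context int_valuation
begin

text \<open>An element or its inverse has nonnegative value, so it is a fraction with denominator or
  numerator 1.\<close>

lemma quotient_field_val_ring:
  assumes "1 \<in> L" "\<And>x y. x \<in> L \<Longrightarrow> y \<in> L \<Longrightarrow> x * y \<in> L" "\<And>x. x \<in> L \<Longrightarrow> inverse x \<in> L"
  shows "quotient_field {x \<in> L. val_ge 0 x} = L"
proof (intro equalityI subsetI)
  fix f assume "f \<in> quotient_field {x \<in> L. val_ge 0 x}"
  then show "f \<in> L"
    using assms(2,3) by (auto simp: quotient_field_def localization_at_def divide_inverse)
next
  fix f assume f: "f \<in> L"
  show "f \<in> quotient_field {x \<in> L. val_ge 0 x}"
  proof (cases "val_ge 0 f")
    case True
    then have "f = f / 1 \<and> f \<in> {x \<in> L. val_ge 0 x} \<and> 1 \<in> {x \<in> L. val_ge 0 x} - {0}"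
      using f assms(1) by simp
    then show ?thesis
      unfolding quotient_field_def localization_at_def by blast
  next
    case False
    then have "f = 1 / inverse f \<and> 1 \<in> {x \<in> L. val_ge 0 x} \<and> inverse f \<in> {x \<in> L. val_ge 0 x} - {0}"
      using f assms(1,3) by (auto simp: val_ge_def val_inverse divide_inverse)
    then show ?thesis
      unfolding quotient_field_def localization_at_def by blast
  qed
qed

text \<open>If f had negative value, the leading term f^n of a monic equation would have value n
  w(f), whereas all other terms have value at least (n - 1) w(f), which is larger.\<close>

lemma val_ring_integrally_closed:
  assumes f: "integral_over A f" and A: "\<And>a. a \<in> A \<Longrightarrow> val_ge 0 a"
  shows "val_ge 0 f"
proof (rule ccontr)
  assume "\<not> val_ge 0 f"
  then have f0: "f \<noteq> 0" "w f < 0"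
    by (auto simp: val_ge_def)
  obtain p where p: "lead_coeff p = 1" "\<And>i. Polynomial.coeff p i \<in> A" "poly p f = 0"
    using f by (auto simp: integral_over_def)
  define n where "n = Polynomial.degree p"
  have "poly p f = f ^ n + (\<Sum>i<n. Polynomial.coeff p i * f ^ i)"
    unfolding poly_altdef n_def[symmetric] using p(1)
    by (simp add: n_def lessThan_Suc_atMost[symmetric])
  then have "f ^ n = - (\<Sum>i<n. Polynomial.coeff p i * f ^ i)"
    using p(3) by (simp add: add_eq_0_iff2)
  moreover have "val_ge ((int n - 1) * w f) (\<Sum>i<n. Polynomial.coeff p i * f ^ i)"
  proof (rule val_ge_sum)
    fix i assume "i \<in> {..<n}"
    then have "(int n - 1) * w f \<le> int i * w f"
      using f0 by (intro mult_right_mono_neg) auto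
    then show "val_ge ((int n - 1) * w f) (Polynomial.coeff p i * f ^ i)"
      using f0 A[OF p(2)[of i]] by (intro val_ge_0_mult) (simp_all add: val_ge_nonzero val_power)
  qed
  ultimately have "val_ge ((int n - 1) * w f) (f ^ n)"
    by simp
  then show False
    using f0 by (simp add: val_ge_nonzero val_power algebra_simps)
qed

lemma PIdl_val_ring:
  assumes "x \<noteq> 0" "0 \<le> w x"
  shows "PIdl\<^bsub>ring_of {x. val_ge 0 x}\<^esub> x = {f. val_ge (w x) f}"
proof -
  have "f = f / x * x" if "val_ge (w x) f" for f
    using assms by simp
  moreover have "val_ge 0 (f / x)" if "val_ge (w x) f" for f
    using that assms by (cases "f = 0") (auto simp: val_ge_def val_divide)
  moreover have "val_ge (w x) (a * x)" if "val_ge 0 a" for a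
    using that assms by (intro val_ge_0_mult) (simp_all add: val_ge_nonzero)
  ultimately show ?thesis
    unfolding PIdl_ring_of by blast
qed

end

text \<open>The monic equation is X^k - f^k = 0.\<close>

lemma integral_over_root:
  assumes "cring (ring_of A)" "f ^ k \<in> A" "0 < k"
  shows "integral_over A f"
proof -
  let ?p = "Polynomial.monom 1 k + [:- (f ^ k):]"
  have deg: "Polynomial.degree ?p = k"
    using assms(3) by (subst degree_add_eq_left) (auto simp: Polynomial.degree_monom_eq)
  have coeff: "Polynomial.coeff ?p i = (if i = k then 1 else 0) + (if i = 0 then - (f ^ k) else 0)" for i
    by (auto simp: coeff_pCons split: nat.split)
  have "lead_coeff ?p = 1"
    using assms(3) unfolding deg coeff by simp
  moreover have "Polynomial.coeff ?p i \<in> A" for i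
    unfolding coeff using ring_of_closed[OF assms(1)] assms(2,3) by auto
  moreover have "poly ?p f = 0"
    by (simp add: poly_monom)
  ultimately show ?thesis
    unfolding integral_over_def by blast
qed

section \<open>The ring W, its integral closure, and the degree of the quotient fields\<close>

context kummer_monomial
begin

abbreviation "base_ring \<equiv> {a. base.val_ge 0 a}"
abbreviation "base_ideal \<equiv> {a. base.val_ge 1 a}"

lemma val_ge_0_const: "val_ge 0 (const_rf a) \<longleftrightarrow> base.val_ge 0 a"
  using c_pos by (cases "a = 0") (auto simp: val_ge_def base.val_ge_def val_const zero_le_mult_iff)

lemma val_ge_1_const: "val_ge 1 (const_rf a) \<longleftrightarrow> base.val_ge 1 a"
proof (cases "a = 0")
  case False
  have "1 \<le> c * v a \<longleftrightarrow> 1 \<le> v a"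
    using c_pos zero_less_mult_iff[of c "v a"] by (simp add: int_one_le_iff_zero_less)
  with False show ?thesis
    by (simp add: val_ge_def base.val_ge_def val_const)
qed simp

lemma ev_uminus: "ev (- p) = - ev p"
  using ev_simps(3)[of p "- p"] by (simp add: eq_neg_iff_add_eq_0 add.commute del: ev_simps(3))

lemma ev_smult: "ev (smult t p) = const_rf t * ev p"
  using ev_simps(4)[of "[:t:]" p] by simp

text \<open>The ring V[tg] that is localized in \<open>corresponding_rees\<close>.\<close>

definition V_y :: "'f poly fract set" where
  "V_y = generated_subring (const_rf ` base_ring \<union> {y})"

lemma cring_V_y: "cring (ring_of V_y)"
proof (rule cring_ring_ofI)
  show "1 \<in> V_y"
    using generate_ring.one[of "ring_of UNIV"] by (simp add: V_y_def)
  show "a + b \<in> V_y" "a * b \<in> V_y" if "a \<in> V_y" "b \<in> V_y" for a b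
    using generate_ring.eng_add[of _ "ring_of UNIV"] generate_ring.eng_mult[of _ "ring_of UNIV"] that
    by (simp_all add: V_y_def)
  show "- a \<in> V_y" if "a \<in> V_y" for a
    using generate_ring.a_inv[of a "ring_of UNIV"] that
    by (simp add: V_y_def a_inv_ring_of[OF cring_ring_of_UNIV])
qed

lemma V_y_mem: "base.val_ge 0 a \<Longrightarrow> const_rf a \<in> V_y" "y \<in> V_y"
  unfolding V_y_def by (auto intro!: generate_ring.incl)

text \<open>The intersection of F[y] with the valuation ring: by \<open>val_ge_ev_iff\<close> a
  polynomial in \<open>y\<close> has nonnegative value exactly when its coefficients lie in
  V.\<close>

lemma V_y_eq: "V_y = {ev p | p. val_ge 0 (ev p)}"
proof (intro equalityI subsetI)
  fix f assume "f \<in> V_y"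
  then show "f \<in> {ev p | p. val_ge 0 (ev p)}"
    unfolding V_y_def
  proof induction
    case one
    show ?case
      by (auto intro!: exI[of _ 1])
  next
    case (incl h)
    then show ?case
    proof
      assume "h \<in> const_rf ` base_ring"
      then obtain a where "h = ev [:a:]" "base.val_ge 0 a"
        by auto
      then show ?thesis
        by (intro CollectI exI[of _ "[:a:]"]) (simp add: val_ge_0_const)
    next
      assume "h \<in> {y}"
      then show ?thesis
        using val_y y_nonzero by (intro CollectI exI[of _ "[:0, 1:]"]) (simp add: val_ge_nonzero)
    qed
  next
    case (a_inv h)
    then obtain p where "h = ev p" "val_ge 0 (ev p)"
      by blast
    then show ?case
      by (intro CollectI exI[of _ "- p"]) (simp add: ev_uminus a_inv_ring_of[OF cring_ring_of_UNIV])
  next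
    case (eng_add h1 h2)
    then obtain p q where "h1 = ev p" "val_ge 0 (ev p)" "h2 = ev q" "val_ge 0 (ev q)"
      by blast
    then show ?case
      by (intro CollectI exI[of _ "p + q"]) (simp add: val_ge_add)
  next
    case (eng_mult h1 h2)
    then obtain p q where "h1 = ev p" "val_ge 0 (ev p)" "h2 = ev q" "val_ge 0 (ev q)"
      by blast
    then show ?case
      by (intro CollectI exI[of _ "p * q"]) (simp add: val_ge_0_mult)
  qed
next
  fix f assume "f \<in> {ev p | p. val_ge 0 (ev p)}"
  then obtain p where p: "f = ev p" "val_ge 0 (ev p)"
    by blast
  then have "base.val_ge 0 (Polynomial.coeff p l)" for l
    by (simp add: val_ge_ev_iff val_ge_0_const)
  then show "f \<in> V_y"
    unfolding p(1) ev_altdef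
    by (intro ring_of_closed(8)[OF cring_V_y] ring_of_closed(4)[OF cring_V_y]
        ring_of_closed(7)[OF cring_V_y] V_y_mem) simp
qed

text \<open>The bound 1 is coefficientwise too, so an element of positive value is a sum of elements
  of N times powers of \<open>y\<close>.\<close>

lemma ideal_N_V_y: "Idl\<^bsub>ring_of V_y\<^esub> (const_rf ` base_ideal) = {f \<in> V_y. val_ge 1 f}"
proof (rule equalityI)
  interpret V_y: cring "ring_of V_y"
    by (rule cring_V_y)
  have N_sub: "const_rf ` base_ideal \<subseteq> V_y"
    using base.val_ge_mono[of 1 _ 0] by (auto intro!: V_y_mem)
  let ?J = "Idl\<^bsub>ring_of V_y\<^esub> (const_rf ` base_ideal)"
  have J: "ideal ?J (ring_of V_y)"
    using N_sub by (intro V_y.genideal_ideal) simp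
  have "ideal {f \<in> V_y. val_ge 1 f} (ring_of V_y)"
    using ring_of_closed[OF cring_V_y] V_y_eq
    by (intro ideal_ring_ofI cring_V_y) (auto intro: val_ge_add val_ge_0_mult)
  then show "?J \<subseteq> {f \<in> V_y. val_ge 1 f}"
    using N_sub by (intro V_y.genideal_minimal) (auto simp: val_ge_1_const)
  show "{f \<in> V_y. val_ge 1 f} \<subseteq> ?J"
  proof
    fix f assume "f \<in> {f \<in> V_y. val_ge 1 f}"
    then obtain p where p: "f = ev p" "val_ge 1 (ev p)"
      unfolding V_y_eq by blast
    then have "base.val_ge 1 (Polynomial.coeff p l)" for l
      by (simp add: val_ge_ev_iff val_ge_1_const)
    moreover have "const_rf ` base_ideal \<subseteq> ?J"
      using N_sub by (intro V_y.genideal_self) simp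
    ultimately have "const_rf (Polynomial.coeff p l) \<in> ?J" for l
      by blast
    then have trm: "const_rf (Polynomial.coeff p l) * y ^ l \<in> ?J" for l
      using ideal_ring_ofD(4)[OF J ring_of_closed(7)[OF cring_V_y V_y_mem(2), of l]]
      by (simp add: mult.commute)
    have "(\<Sum>l\<in>T. const_rf (Polynomial.coeff p l) * y ^ l) \<in> ?J" for T
      by (induction T rule: infinite_finite_induct) (auto intro: ideal_ring_ofD[OF J] trm)
    then show "f \<in> ?J"
      unfolding p(1) ev_altdef .
  qed
qed

lemma corresponding_rees_eq:
  "corresponding_rees k base_ring base_ideal g = {f \<in> subfield_L. val_ge 0 f}"
proof -
  have "corresponding_rees k base_ring base_ideal g = localization_at V_y {f \<in> V_y. val_ge 1 f}"
    unfolding corresponding_rees_def y_def[symmetric] V_y_def[symmetric] Let_def ideal_N_V_y ..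
  also have "\<dots> = {f \<in> subfield_L. val_ge 0 f}"
  proof (intro equalityI subsetI)
    fix f assume "f \<in> localization_at V_y {f \<in> V_y. val_ge 1 f}"
    then obtain a t where f: "f = a / t" "a \<in> V_y" "t \<in> V_y" "\<not> val_ge 1 t"
      unfolding localization_at_def by blast
    then obtain p q where pq: "a = ev p" "val_ge 0 (ev p)" "t = ev q" "val_ge 0 (ev q)"
      unfolding V_y_eq by blast
    have t: "t \<noteq> 0" "w t = 0"
      using f(4) pq by (auto simp: val_ge_def)
    then have "val_ge 0 f"
      using f(1) pq by (cases "a = 0") (auto simp: val_ge_def val_divide)
    then show "f \<in> {f \<in> subfield_L. val_ge 0 f}"
      using f(1) pq by (auto intro: ev_in_L)
  next
    fix f assume "f \<in> {f \<in> subfield_L. val_ge 0 f}"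
    then obtain p q where pq: "q \<noteq> 0" "f = ev p / ev q" "val_ge 0 f"
      by (auto elim: subfield_LE)
    obtain l where l: "Polynomial.coeff q l \<noteq> 0" "w (ev q) = c * v (Polynomial.coeff q l)"
      using val_ev[OF pq(1)] by blast
    \<comment> \<open>Rescaling by a coefficient of \<open>q\<close> that attains its value gives
      the denominator value 0. Since \<open>f\<close> has nonnegative value, the rescaled numerator
      then lies in V[y].\<close>
    define t where "t = inverse (Polynomial.coeff q l)"
    have t: "t \<noteq> 0"
      using l by (simp add: t_def)
    have wq: "w (ev (smult t q)) = 0"
      using l pq(1) t by (simp add: ev_smult val_mult val_const val_inverse t_def)
    have fq: "f * ev (smult t q) = ev (smult t p)"
      using pq by (simp add: ev_smult)
    have q0: "ev (smult t q) \<noteq> 0"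
      using t pq(1) by simp
    have "val_ge 0 (ev (smult t p))"
      unfolding fq[symmetric] using pq(3) q0 wq by (intro val_ge_0_mult) (simp_all add: val_ge_nonzero)
    then have "ev (smult t p) \<in> V_y"
      unfolding V_y_eq by blast
    moreover have "ev (smult t q) \<in> V_y - {f \<in> V_y. val_ge 1 f}"
      using wq q0 unfolding V_y_eq by (auto simp: val_ge_nonzero)
    moreover have "f = ev (smult t p) / ev (smult t q)"
      using fq q0 by (simp add: field_simps)
    ultimately show "f \<in> localization_at V_y {f \<in> V_y. val_ge 1 f}"
      unfolding localization_at_def by blast
  qed
  finally show ?thesis .
qed

lemma cring_L: "cring (ring_of subfield_L)"
  by (intro cring_ring_ofI) auto

text \<open>The hypothesis that the integral closure is a ring serves to add up the terms of the
  expansion of f, each integral as a k-th root of an element of W. It is later supplied by U being a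
  discrete valuation ring.\<close>

lemma integral_closure_rees_eq:
  assumes U: "cring (ring_of (integral_closure_in {f \<in> subfield_L. val_ge 0 f} UNIV))"
  shows "integral_closure_in {f \<in> subfield_L. val_ge 0 f} UNIV = {f. val_ge 0 f}"
proof (intro equalityI subsetI)
  fix f assume "f \<in> integral_closure_in {f \<in> subfield_L. val_ge 0 f} UNIV"
  then show "f \<in> {f. val_ge 0 f}"
    by (auto simp: integral_closure_in_def intro: val_ring_integrally_closed)
next
  fix f assume f: "f \<in> {f. val_ge 0 f}"
  obtain a where "\<forall>i<k. a i \<in> subfield_L" and a_sum: "f = (\<Sum>i<k. a i * u_root_rf ^ i)"
    using L_combination_exists[of f] by blast
  then have a: "a i \<in> subfield_L" if "i < k" for i
    using that by blast
  have "a i * u_root_rf ^ i \<in> integral_closure_in {f \<in> subfield_L. val_ge 0 f} UNIV" if i: "i < k" for i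
  proof -
    have "val_ge 0 (a i * u_root_rf ^ i)"
      using f a_sum by (intro val_ge_L_combination[of a, OF a _ i]) simp_all
    then have "val_ge 0 ((a i * u_root_rf ^ i) ^ k)"
      by (rule val_ge_power)
    moreover have "(a i * u_root_rf ^ i) ^ k = a i ^ k * (u_root_rf ^ k) ^ i"
      by (simp add: power_mult_distrib mult.commute flip: power_mult)
    then have "(a i * u_root_rf ^ i) ^ k \<in> subfield_L"
      using a[OF i] u_root_power_k_in_L by (auto intro: L_mult L_power)
    ultimately have "integral_over {f \<in> subfield_L. val_ge 0 f} (a i * u_root_rf ^ i)"
      using k_pos by (intro integral_over_root[of _ _ k] cring_val_ring cring_L) auto
    then show ?thesis
      by (simp add: integral_closure_in_def)
  qed
  then show "f \<in> integral_closure_in {f \<in> subfield_L. val_ge 0 f} UNIV"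
    unfolding a_sum by (intro ring_of_closed(8)[OF U]) simp
qed

lemma has_quotient_field_degree_L:
  "has_quotient_field_degree {f. val_ge 0 f} {f \<in> subfield_L. val_ge 0 f} k"
proof -
  have UF: "quotient_field {f. val_ge 0 f} = UNIV"
    using quotient_field_val_ring[of UNIV] by simp
  have WF: "quotient_field {f \<in> subfield_L. val_ge 0 f} = subfield_L"
    by (rule quotient_field_val_ring) auto
  have "id \<in> ring_hom (ring_of (UNIV :: 'f poly fract set)) (ring_of UNIV)"
    by (rule ring_hom_memI) simp_all
  then have "ring.dimension (ring_of UNIV) k (id ` subfield_L)
      (id ` {\<Sum>i<k. a i * u_root_rf ^ i | a. \<forall>i<k. a i \<in> subfield_L})"
  proof (rule dimension_image_combinations[OF cring_ring_of_UNIV cring.axioms(1)[OF cring_ring_of_UNIV]])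
    fix j and a :: "nat \<Rightarrow> 'f poly fract"
    assume j: "j < k" and a: "\<And>i. i < j \<Longrightarrow> a i \<in> subfield_L"
    show "id (u_root_rf ^ j) \<noteq> id (\<Sum>i<j. a i * u_root_rf ^ i)"
    proof
      assume eq: "id (u_root_rf ^ j) = id (\<Sum>i<j. a i * u_root_rf ^ i)"
      \<comment> \<open>Moves \<open>u_root_rf ^ j\<close> to the other side and pads with zeros up
        to length \<open>k\<close>. Each term of the resulting zero sum satisfies every bound and so
        vanishes, although the coefficient at \<open>j\<close> is -1.\<close>
      define a' where "a' i = (if i < j then a i else if i = j then - 1 else 0)" for i
      have "(\<Sum>i<k. a' i * u_root_rf ^ i) = (\<Sum>i<Suc j. a' i * u_root_rf ^ i)"
        using j by (intro sum.mono_neutral_right) (auto simp: a'_def)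
      also have "\<dots> = 0"
        using eq by (simp add: a'_def)
      finally have sum0: "(\<Sum>i<k. a' i * u_root_rf ^ i) = 0" .
      have "a' i \<in> subfield_L" for i
        using a L_uminus[OF L_closed(2)] by (auto simp: a'_def)
      then have "val_ge m (a' j * u_root_rf ^ j)" for m
        using sum0 by (intro val_ge_L_combination j) auto
      then have "a' j * u_root_rf ^ j = 0"
        by (rule val_ge_all_imp_0)
      then show False
        by (simp add: a'_def)
    qed
  qed auto
  moreover have "{\<Sum>i<k. a i * u_root_rf ^ i | a. \<forall>i<k. a i \<in> subfield_L} = UNIV"
  proof (rule equalityI[OF subset_UNIV subsetI])
    fix f :: "'f poly fract"
    show "f \<in> {\<Sum>i<k. a i * u_root_rf ^ i | a. \<forall>i<k. a i \<in> subfield_L}"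
      using L_combination_exists[of f] by blast
  qed
  ultimately show ?thesis
    by (simp add: has_quotient_field_degree_def UF WF)
qed

end

section \<open>Ramification and residue degree\<close>

text \<open>Serves to pass from sums over d powers of an element proportional to x^c to sums over cd
  powers of x, supported on the multiples of \<open>c\<close>.\<close>

lemma sum_multiples:
  fixes F :: "nat \<Rightarrow> 'a::comm_monoid_add"
  assumes "0 < c"
  shows "(\<Sum>n<c * d. if c dvd n then F (n div c) else 0) = (\<Sum>i<d. F i)"
proof -
  have "(\<Sum>n<c * d. if c dvd n then F (n div c) else 0)
      = (\<Sum>n\<in>(\<lambda>i. c * i) ` {..<d}. if c dvd n then F (n div c) else 0)"
    using assms by (intro sum.mono_neutral_right) (auto elim: dvdE)
  also have "\<dots> = (\<Sum>i<d. F i)"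
    using assms by (subst sum.reindex) (auto simp: inj_on_def)
  finally show ?thesis .
qed

lemma quot_eq_iff_ring_of:
  assumes A: "cring (ring_of A)" and P: "ideal P (ring_of A)" and "a \<in> A" "b \<in> A"
  shows "P +>\<^bsub>ring_of A\<^esub> a = P +>\<^bsub>ring_of A\<^esub> b \<longleftrightarrow> a - b \<in> P"
proof -
  interpret cring "ring_of A" by fact
  show ?thesis
    using quotient_eq_iff_same_a_r_cos[OF P, of a b] assms
    by (simp add: a_minus_def a_inv_ring_of[OF A])
qed

text \<open>An element of value 1 generates the ideal of positive values, so its powers are
  principal, generated by the powers of that element.\<close>

lemma (in int_valuation) val_ideal_pow:
  assumes x: "x \<noteq> 0" "w x = 1"
  shows "{f. val_ge 1 f} [^]\<^bsub>ideals_set (ring_of {f. val_ge 0 f})\<^esub> (n :: nat) = {f. val_ge (int n) f}"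
proof -
  let ?U = "{f. val_ge 0 f}"
  interpret U: cring "ring_of ?U"
    using cring_val_ring[OF cring_ring_of_UNIV] by simp
  have "{f. val_ge 1 f} = PIdl\<^bsub>ring_of ?U\<^esub> x"
    using PIdl_val_ring[OF x(1)] x(2) by simp
  moreover have "x \<in> carrier (ring_of ?U)"
    using x by (simp add: val_ge_nonzero)
  ultimately have "{f. val_ge 1 f} [^]\<^bsub>ideals_set (ring_of ?U)\<^esub> n = PIdl\<^bsub>ring_of ?U\<^esub> (x ^ n)"
    using U.ideals_set_pow_cgenideal[of x n] by (simp add: nat_pow_ring_of)
  then show ?thesis
    using PIdl_val_ring[of "x ^ n"] x by (simp add: val_power)
qed

locale kummer_uniformized = kummer_monomial v w "int c" s k g
  for v :: "'f::field \<Rightarrow> int" and w c s k g +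
  fixes d :: nat and \<pi> :: 'f
  assumes k_eq: "k = c * d" and coprime_sc: "coprime s (int c)"
    and \<pi>_nonzero: "\<pi> \<noteq> 0" and val_\<pi>: "v \<pi> = 1"
begin

abbreviation "U \<equiv> {f. val_ge 0 f}"
abbreviation "W \<equiv> {f \<in> subfield_L. val_ge 0 f}"
abbreviation "P \<equiv> {f. val_ge 1 f}"

lemma cring_U: "cring (ring_of U)"
  using cring_val_ring[OF cring_ring_of_UNIV] by simp

lemma ideal_U: "0 \<le> n \<Longrightarrow> ideal {f. val_ge n f} (ring_of U)"
  using ideal_val_ge[OF cring_ring_of_UNIV] by simp

text \<open>Elements of N have value at least \<open>c\<close> under \<open>w\<close>, and \<pi> has
  exactly this value, so \<pi> alone generates the extended ideal.\<close>

lemma ideal_N_U: "Idl\<^bsub>ring_of U\<^esub> (const_rf ` base_ideal) = {f. val_ge (int c) f}"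
proof (rule equalityI)
  interpret U: cring "ring_of U"
    by (rule cring_U)
  have N_c: "val_ge (int c) (const_rf a)" if "base.val_ge 1 a" for a
    using that c_pos by (cases "a = 0") (simp_all add: val_ge_nonzero base.val_ge_nonzero val_const)
  then have N_sub: "const_rf ` base_ideal \<subseteq> {f. val_ge (int c) f}"
    by blast
  then show "Idl\<^bsub>ring_of U\<^esub> (const_rf ` base_ideal) \<subseteq> {f. val_ge (int c) f}"
    by (intro U.genideal_minimal ideal_U) auto
  have "const_rf ` base_ideal \<subseteq> U"
    using N_sub val_ge_mono[of "int c" _ 0] by auto
  then have J: "ideal (Idl\<^bsub>ring_of U\<^esub> (const_rf ` base_ideal)) (ring_of U)"
    "const_rf ` base_ideal \<subseteq> Idl\<^bsub>ring_of U\<^esub> (const_rf ` base_ideal)"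
    by (intro U.genideal_ideal U.genideal_self; simp)+
  show "{f. val_ge (int c) f} \<subseteq> Idl\<^bsub>ring_of U\<^esub> (const_rf ` base_ideal)"
  proof
    fix f assume f: "f \<in> {f. val_ge (int c) f}"
    have "w (const_rf \<pi>) = int c"
      using \<pi>_nonzero by (simp add: val_const val_\<pi>)
    then have "f / const_rf \<pi> \<in> U"
      using f \<pi>_nonzero by (cases "f = 0") (auto simp: val_ge_def val_divide)
    moreover have "const_rf \<pi> \<in> Idl\<^bsub>ring_of U\<^esub> (const_rf ` base_ideal)"
      using J(2) \<pi>_nonzero val_\<pi> by (auto simp: base.val_ge_nonzero)
    ultimately have "f / const_rf \<pi> * const_rf \<pi> \<in> Idl\<^bsub>ring_of U\<^esub> (const_rf ` base_ideal)"
      by (rule ideal_ring_ofD(4)[OF J(1)])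
    then show "f \<in> Idl\<^bsub>ring_of U\<^esub> (const_rf ` base_ideal)"
      using \<pi>_nonzero by simp
  qed
qed

text \<open>Bezout coefficients for the coprime \<open>s\<close> and \<open>c\<close> give the
  uniformizer x^\<alpha> \<pi>^\<beta>, of value \<alpha> s + \<beta> c = 1.\<close>

lemma P_pow: "P [^]\<^bsub>ideals_set (ring_of U)\<^esub> n = {f. val_ge (int n) f}"
proof -
  obtain \<alpha> \<beta> where "\<alpha> * s + \<beta> * int c = 1"
    using bezout_int[of s "int c"] coprime_sc by auto
  then show ?thesis
    using \<pi>_nonzero
    by (intro val_ideal_pow[of "u_root_rf powi \<alpha> * const_rf \<pi> powi \<beta>"])
      (simp_all add: val_mult val_power_int val_u_root val_const val_\<pi>)
qed

definition z :: "'f poly fract" where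
  "z = const_rf \<pi> powi - s * u_root_rf ^ c"

lemma z_nonzero: "z \<noteq> 0"
  using \<pi>_nonzero by (simp add: z_def)

lemma val_z: "w z = 0"
  using \<pi>_nonzero
  by (simp add: z_def val_mult val_power_int val_power val_const val_\<pi> val_u_root)

lemma \<pi>_powi_in_L: "const_rf \<pi> powi n \<in> subfield_L"
  by (simp add: power_int_def L_power L_inverse)

lemma z_power: "z ^ i = const_rf \<pi> powi (- s * int i) * u_root_rf ^ (c * i)"
  unfolding z_def power_mult_distrib power_int_mult by (simp flip: power_mult)

lemma val_ge_mult_z: "val_ge m (a * z ^ i) \<longleftrightarrow> val_ge m a"
  using val_ge_mult_iff[of "z ^ i" m a] z_nonzero val_z by (simp add: val_power mult.commute)

lemma c_pos_nat: "0 < c"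
  using c_pos by simp

lemma val_ge_z_combination:
  assumes a: "\<And>i. i < d \<Longrightarrow> a i \<in> subfield_L" and ge: "val_ge m (\<Sum>i<d. a i * z ^ i)" and i: "i < d"
  shows "val_ge m (a i)"
proof -
  \<comment> \<open>The coefficients of the same sum written in powers of x, zero at indices not
    divisible by \<open>c\<close>; this brings it into the form of
    \<open>val_ge_L_combination\<close>.\<close>
  define b where "b n = (if c dvd n then a (n div c) * const_rf \<pi> powi (- s * int (n div c)) else 0)" for n
  have b: "b n * u_root_rf ^ n = (if c dvd n then a (n div c) * z ^ (n div c) else 0)" for n
    by (auto simp: b_def z_power mult.assoc)
  have "(\<Sum>n<k. b n * u_root_rf ^ n) = (\<Sum>i<d. a i * z ^ i)"
    unfolding b k_eq by (rule sum_multiples[OF c_pos_nat])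
  then have "val_ge m (\<Sum>n<k. b n * u_root_rf ^ n)"
    using ge by simp
  moreover have "b n \<in> subfield_L" if "n < k" for n
  proof -
    have "n div c < d"
      using that k_eq by (metis less_mult_imp_div_less mult.commute)
    then show ?thesis
      using a \<pi>_powi_in_L by (simp add: b_def L_mult)
  qed
  moreover have "c * i < k"
    using i c_pos_nat by (simp add: k_eq)
  ultimately have "val_ge m (b (c * i) * u_root_rf ^ (c * i))"
    by (intro val_ge_L_combination)
  then show ?thesis
    using c_pos_nat by (simp add: b val_ge_mult_z)
qed

lemma z_combination_exists:
  assumes "val_ge 0 f"
  shows "\<exists>a. (\<forall>i<d. a i \<in> W) \<and> val_ge 1 (f - (\<Sum>i<d. a i * z ^ i))"
proof -
  obtain b where "\<forall>n<k. b n \<in> subfield_L" and f: "f = (\<Sum>n<k. b n * u_root_rf ^ n)"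
    using L_combination_exists[of f] by blast
  then have b: "b n \<in> subfield_L" if "n < k" for n
    using that by blast
  have bx: "val_ge 0 (b n * u_root_rf ^ n)" if "n < k" for n
    using assms f that by (intro val_ge_L_combination b) simp_all
  \<comment> \<open>Rescaled so that \<open>a i * z ^ i\<close> is the term of \<open>f\<close> with
    index \<open>c * i\<close>; the terms with index not divisible by \<open>c\<close> form the
    remainder.\<close>
  define a where "a i = b (c * i) * const_rf \<pi> powi (s * int i)" for i
  have az: "a i * z ^ i = b (c * i) * u_root_rf ^ (c * i)" for i
    using \<pi>_nonzero by (simp add: a_def z_power power_int_minus mult.assoc)
  have "a i \<in> W" if "i < d" for i
  proof -
    have ci: "c * i < k"
      using that c_pos_nat by (simp add: k_eq)
    have "val_ge 0 (a i)"
      using bx[OF ci] by (simp add: val_ge_mult_z flip: az)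
    then show ?thesis
      using b[OF ci] \<pi>_powi_in_L by (auto simp: a_def intro: L_mult)
  qed
  moreover have "f - (\<Sum>i<d. a i * z ^ i) = (\<Sum>n<k. if c dvd n then 0 else b n * u_root_rf ^ n)"
  proof -
    have "(\<Sum>i<d. a i * z ^ i) = (\<Sum>n<k. if c dvd n then a (n div c) * z ^ (n div c) else 0)"
      unfolding k_eq by (rule sum_multiples[OF c_pos_nat, symmetric])
    also have "\<dots> = (\<Sum>n<k. if c dvd n then b n * u_root_rf ^ n else 0)"
      by (intro sum.cong) (auto simp: az)
    finally show ?thesis
      unfolding f by (simp flip: sum_subtractf) (intro sum.cong, auto)
  qed
  \<comment> \<open>The value of the coefficient is a multiple of \<open>c\<close>, while n s is
    not, because \<open>s\<close> is prime to \<open>c\<close>. So the value of the term is not 0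
    and, being nonnegative, is at least 1.\<close>
  moreover have "val_ge 1 (if c dvd n then 0 else b n * u_root_rf ^ n)" if n: "n < k" for n
  proof (cases "c dvd n \<or> b n = 0")
    case False
    have "int c dvd w (b n)"
      using val_L[OF b[OF n]] False by blast
    moreover have "\<not> int c dvd int n * s"
      using False coprime_sc by (simp add: coprime_dvd_mult_left_iff coprime_commute)
    ultimately have "\<not> int c dvd w (b n) + int n * s"
      by (simp add: dvd_add_right_iff)
    then have "w (b n * u_root_rf ^ n) \<noteq> 0"
      using False by (auto simp: val_mult val_power val_u_root)
    then show ?thesis
      using bx[OF n] False by (simp add: val_ge_def)
  qed auto
  then have "val_ge 1 (\<Sum>n<k. if c dvd n then 0 else b n * u_root_rf ^ n)"
    by (intro val_ge_sum) simp
  ultimately show ?thesis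
    by (intro exI[of _ a]) simp
qed

lemma z_power_in_U: "z ^ i \<in> U"
  using val_ge_mult_z[of 0 1 i] by simp

lemma has_residue_degree_U: "has_residue_degree U P W d"
proof -
  let ?h = "(+>\<^bsub>ring_of U\<^esub>) P"
  have P: "ideal P (ring_of U)"
    by (rule ideal_U) simp
  interpret P: ideal P "ring_of U"
    by (rule P)
  have h_eq: "?h a = ?h b \<longleftrightarrow> val_ge 1 (a - b)" if "val_ge 0 a" "val_ge 0 b" for a b
    using quot_eq_iff_ring_of[OF cring_U P, of a b] that by simp
  have z_comb: "val_ge 0 (\<Sum>i<j. a i * z ^ i)" if "\<And>i. i < j \<Longrightarrow> a i \<in> W" for a and j :: nat
    using that by (intro val_ge_sum) (simp add: val_ge_mult_z)
  have "ring.dimension (ring_of U Quot P) d (?h ` W) (?h ` {\<Sum>i<d. a i * z ^ i | a. \<forall>i<d. a i \<in> W})"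
  proof (rule dimension_image_combinations[OF cring_U P.quotient_is_ring P.rcos_ring_hom])
    fix j and a :: "nat \<Rightarrow> 'f poly fract"
    assume j: "j < d" and a: "\<And>i. i < j \<Longrightarrow> a i \<in> W"
    show "?h (z ^ j) \<noteq> ?h (\<Sum>i<j. a i * z ^ i)"
    proof
      assume "?h (z ^ j) = ?h (\<Sum>i<j. a i * z ^ i)"
      then have ge: "val_ge 1 (z ^ j - (\<Sum>i<j. a i * z ^ i))"
        using z_power_in_U[of j] z_comb[OF a] h_eq by simp
      \<comment> \<open>The relation is padded to full length \<open>d\<close>. Positivity of the
        sum then forces every coefficient to have positive value, which fails for the coefficient 1
        at \<open>j\<close>.\<close>
      define a' where "a' i = (if i < j then - a i else if i = j then 1 else 0)" for i
      have "(\<Sum>i<d. a' i * z ^ i) = (\<Sum>i<Suc j. a' i * z ^ i)"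
        using j by (intro sum.mono_neutral_right) (auto simp: a'_def)
      also have "\<dots> = z ^ j - (\<Sum>i<j. a i * z ^ i)"
        by (simp add: a'_def sum_negf)
      finally have "val_ge 1 (\<Sum>i<d. a' i * z ^ i)"
        using ge by simp
      moreover have "a' i \<in> subfield_L" for i
        using a[of i] by (auto simp: a'_def)
      ultimately have "val_ge 1 (a' j)"
        by (intro val_ge_z_combination[of a'] j) auto
      then show False
        by (simp add: a'_def)
    qed
  qed (use z_power_in_U in auto)
  moreover have "?h ` {\<Sum>i<d. a i * z ^ i | a. \<forall>i<d. a i \<in> W} = carrier (ring_of U Quot P)"
  proof (rule equalityI)
    have carr: "carrier (ring_of U Quot P) = ?h ` U"
      by (auto simp: FactRing_def A_RCOSETS_def')
    have "(\<Sum>i<d. a i * z ^ i) \<in> U" if "\<forall>i<d. a i \<in> W" for a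
      using z_comb[of d a] that by blast
    then show "?h ` {\<Sum>i<d. a i * z ^ i | a. \<forall>i<d. a i \<in> W} \<subseteq> carrier (ring_of U Quot P)"
      unfolding carr by blast
    show "carrier (ring_of U Quot P) \<subseteq> ?h ` {\<Sum>i<d. a i * z ^ i | a. \<forall>i<d. a i \<in> W}"
    proof
      fix F assume "F \<in> carrier (ring_of U Quot P)"
      then obtain f where f: "val_ge 0 f" "F = ?h f"
        unfolding carr by blast
      obtain a where a: "\<forall>i<d. a i \<in> W" "val_ge 1 (f - (\<Sum>i<d. a i * z ^ i))"
        using z_combination_exists[OF f(1)] by blast
      then have F: "F = ?h (\<Sum>i<d. a i * z ^ i)"
        unfolding f(2) using h_eq[OF f(1)] z_comb[of d a] by blast
      show "F \<in> ?h ` {\<Sum>i<d. a i * z ^ i | a. \<forall>i<d. a i \<in> W}"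
        unfolding F using a(1) by (intro imageI) blast
    qed
  qed
  ultimately show ?thesis
    by (simp add: has_residue_degree_def)
qed

text \<open>For \<open>d = 1\<close> the only power of \<open>z\<close> in the basis is 1, so every
  residue class is represented in W. The residue map of U restricted to W is thus onto, with kernel
  the elements of W of positive value.\<close>

lemma residue_field_iso:
  assumes "d = 1"
  shows "ring_of U Quot P \<simeq> ring_of W Quot {f \<in> subfield_L. val_ge 1 f}"
proof -
  let ?h = "(+>\<^bsub>ring_of U\<^esub>) P"
  have P: "ideal P (ring_of U)"
    by (rule ideal_U) simp
  interpret P: ideal P "ring_of U"
    by (rule P)
  have cW: "cring (ring_of W)"
    by (rule cring_val_ring[OF cring_L])
  interpret Q: ideal "{f \<in> subfield_L. val_ge 1 f}" "ring_of W"
    using ideal_val_ge[OF cring_L] by simp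
  have "?h \<in> ring_hom (ring_of W) (ring_of U Quot P)"
    using ring_hom_memE[OF P.rcos_ring_hom] by (intro ring_hom_memI) auto
  then interpret h: ring_hom_ring "ring_of W" "ring_of U Quot P" ?h
    by (intro ring_hom_ringI2 cring.axioms(1)[OF cW] P.quotient_is_ring)
  have h_eq: "?h a = ?h b \<longleftrightarrow> val_ge 1 (a - b)" if "val_ge 0 a" "val_ge 0 b" for a b
    using quot_eq_iff_ring_of[OF cring_U P, of a b] that by simp
  have "?h ` W = ?h ` U"
  proof (rule equalityI)
    show "?h ` U \<subseteq> ?h ` W"
    proof clarify
      fix f assume f: "val_ge 0 f"
      obtain a where a: "a 0 \<in> W" "val_ge 1 (f - a 0)"
        using z_combination_exists[OF f] assms by auto
      then have "?h f = ?h (a 0)"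
        using h_eq f by blast
      then show "?h f \<in> ?h ` W"
        using a(1) by blast
    qed
  qed auto
  moreover have "carrier (ring_of U Quot P) = ?h ` U"
    by (auto simp: FactRing_def A_RCOSETS_def')
  ultimately have "?h ` carrier (ring_of W) = carrier (ring_of U Quot P)"
    by simp
  then have "ring_of W Quot a_kernel (ring_of W) (ring_of U Quot P) ?h \<simeq> ring_of U Quot P"
    by (rule h.FactRing_iso)
  moreover have "a_kernel (ring_of W) (ring_of U Quot P) ?h = {f \<in> subfield_L. val_ge 1 f}"
  proof -
    have "?h f = \<zero>\<^bsub>ring_of U Quot P\<^esub> \<longleftrightarrow> val_ge 1 f" if "f \<in> W" for f
    proof -
      have "\<zero>\<^bsub>ring_of U Quot P\<^esub> = ?h 0"
        using P.a_rcos_zero[OF P, of 0] by (simp add: FactRing_def)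
      then show ?thesis
        using h_eq[of f 0] that by simp
    qed
    then show ?thesis
      unfolding a_kernel_def' using val_ge_mono[of 1 _ 0] by auto
  qed
  ultimately show ?thesis
    using ring_iso_sym[OF Q.quotient_is_ring] by simp
qed

end

section \<open>The Rees valuation ring of the ideal\<close>

lemma to_tquot_simps:
  "to_tquot 0 = 0" "to_tquot 1 = 1" "to_tquot (x + y) = to_tquot x + to_tquot y"
  "to_tquot (x * y) = to_tquot x * to_tquot y" "to_tquot (- x) = - to_tquot x"
  by (simp_all add: to_tquot_def zero_tquot_eq one_tquot_eq TFrac_add TFrac_mult TFrac_uminus)

lemma nonzerodivisor_to_tquotD:
  assumes "nonzerodivisor (to_tquot b)"
  shows "nonzerodivisor b"
  unfolding nonzerodivisor_def
proof (intro allI impI)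
  fix x assume "b * x = 0"
  then have "to_tquot b * to_tquot x = 0"
    by (simp flip: to_tquot_simps)
  then have "to_tquot x = to_tquot 0"
    using assms by (simp add: nonzerodivisor_def to_tquot_simps)
  then show "x = 0"
    by (rule injD[OF inj_to_tquot])
qed

lemma subring_subset_integral_closure: "generated_subring H \<subseteq> integral_closure (generated_subring H)"
proof
  fix x assume x: "x \<in> generated_subring H"
  let ?A = "generated_subring H"
  have 1: "1 \<in> ?A"
    using generate_ring.one[of "ring_of UNIV"] by simp
  have uminus: "- a \<in> ?A" if "a \<in> ?A" for a
    using generate_ring.a_inv[OF that] by (simp add: a_inv_ring_of[OF cring_ring_of_UNIV])
  have "0 \<in> ?A"
    using generate_ring.eng_add[OF 1 uminus[OF 1]] by simp
  then have "Polynomial.coeff [:- x, 1:] i \<in> ?A" for i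
    using 1 uminus[OF x] by (auto simp: coeff_pCons split: nat.split)
  then have "integral_over ?A x"
    unfolding integral_over_def by (intro exI[of _ "[:- x, 1:]"]) simp
  moreover have "x \<in> total_quotients ?A"
    unfolding total_quotients_def using x 1 by (intro CollectI bexI[of _ x] bexI[of _ 1]) simp_all
  ultimately show "x \<in> integral_closure ?A"
    by (simp add: integral_closure_def integral_closure_in_def)
qed

text \<open>Images are fractions with denominator 1, which is admissible because 1 is not in the
  image of \<open>p\<close>: if q in \<open>p\<close> mapped to 1, then q - 1 would lie in the
  kernel, hence in \<open>p\<close>, and so would 1.\<close>

lemma valuation_ring_through_image:
  assumes "valuation_ring_through A J \<phi> D"
  shows "\<phi> ` A \<subseteq> D" "\<phi> \<in> ring_hom (ring_of A) (ring_of UNIV)"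
proof -
  obtain p z where p: "primeideal p (ring_of A)" and z: "z \<subseteq> p"
    and hom: "\<phi> \<in> ring_hom (ring_of A) (ring_of UNIV)"
    and ker: "a_kernel (ring_of A) (ring_of UNIV) \<phi> = z"
    and D: "D = localization_at (\<phi> ` A) (\<phi> ` p)"
    using assms unfolding valuation_ring_through_def associated_prime_def by blast
  interpret p: primeideal p "ring_of A"
    by (rule p)
  have A: "cring (ring_of A)"
    by (rule p.is_cring)
  note closed = ring_of_closed[OF A] and pD = ideal_ring_ofD[OF p.is_ideal]
  have add: "\<phi> (x + y) = \<phi> x + \<phi> y" if "x \<in> A" "y \<in> A" for x y
    using ring_hom_add[OF hom, of x y] that by simp
  have one: "\<phi> 1 = 1"
    using ring_hom_one[OF hom] by simp
  have "1 \<notin> \<phi> ` p"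
  proof
    assume "1 \<in> \<phi> ` p"
    then obtain q where q: "q \<in> p" "\<phi> q = 1"
      by auto
    have "\<phi> 0 = 0"
      using add[OF closed(1) closed(1)] by (metis add_cancel_right_right add_0)
    then have "\<phi> (- 1) = - 1"
      using add[of 1 "- 1"] closed(2,5) one by (simp add: add_eq_0_iff)
    then have "\<phi> (q + - 1) = 0"
      using add[of q "- 1"] q pD(1) closed(2,5) by (simp add: subset_iff)
    moreover have "q + - 1 \<in> A"
      using q(1) pD(1) closed(2,3,5) by blast
    ultimately have "q + - 1 \<in> p"
      using z by (auto simp flip: ker simp: a_kernel_def')
    then have "- 1 * (q + - 1) \<in> p"
      using pD(4) closed(2,5) by blast
    then have "q + - 1 * (q + - 1) \<in> p"
      by (rule pD(3)[OF q(1)])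
    then have "\<one>\<^bsub>ring_of A\<^esub> \<in> p"
      by simp
    then show False
      using p.one_imp_carrier p.I_notcarr by simp
  qed
  then have "\<phi> x \<in> D" if "x \<in> A" for x
    unfolding D localization_at_def
    using that closed(2) one by (intro CollectI exI[of _ "\<phi> x"] exI[of _ 1]) (auto intro: image_eqI[of _ \<phi> 1])
  then show "\<phi> ` A \<subseteq> D"
    by blast
  show "\<phi> \<in> ring_hom (ring_of A) (ring_of UNIV)"
    by (rule hom)
qed

text \<open>All elements of \<open>I\<close> are multiples of \<open>b\<close> already in \<open>R[I/b]\<close>.\<close>

lemma rees_valuation_ring_generator:
  assumes "rees_valuation_ring_through (range to_tquot) (to_tquot ` I) (to_tquot b) \<phi> V"
  shows "discrete_valuation_ring V" "b \<in> I" "\<phi> (to_tquot b) \<in> V"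
    "\<And>a. a \<in> I \<Longrightarrow> \<exists>r\<in>V. \<phi> (to_tquot a) = r * \<phi> (to_tquot b)"
proof -
  define H where "H = range to_tquot \<union> {x. to_tquot b * x \<in> to_tquot ` I}"
  define C where "C = integral_closure (generated_subring H)"
  obtain B where B: "B \<subseteq> range to_tquot" "\<forall>x\<in>B. nonzerodivisor x"
    "to_tquot ` I = Idl\<^bsub>ring_of (range to_tquot)\<^esub> B" "to_tquot b \<in> B"
    and V: "valuation_ring_through C (PIdl\<^bsub>ring_of C\<^esub> (to_tquot b)) \<phi> V"
    using assms unfolding rees_valuation_ring_through_def affine_blowup_def H_def C_def Let_def by blast
  show "discrete_valuation_ring V"
    using V by (simp add: valuation_ring_through_def)
  have b: "nonzerodivisor b"
    using B nonzerodivisor_to_tquotD by blast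
  have "cring (ring_of (range (to_tquot :: 'a \<Rightarrow> 'a tquot)))"
    by (intro cring_ring_ofI) (auto simp flip: to_tquot_simps)
  then interpret R: cring "ring_of (range (to_tquot :: 'a \<Rightarrow> 'a tquot))" .
  have "B \<subseteq> to_tquot ` I"
    unfolding B(3) using B(1) by (intro R.genideal_self) simp
  then have "to_tquot b \<in> to_tquot ` I"
    using B(4) by blast
  then show bI: "b \<in> I"
    by (simp add: inj_image_mem_iff[OF inj_to_tquot])
  have H: "H \<subseteq> C"
    unfolding C_def using subring_subset_integral_closure[of H] by (auto intro: generate_ring.incl)
  note img = valuation_ring_through_image[OF V]
  have C: "to_tquot x \<in> C" for x
    using H by (auto simp: H_def)
  then show "\<phi> (to_tquot b) \<in> V"
    using img(1) by blast
  show "\<exists>r\<in>V. \<phi> (to_tquot a) = r * \<phi> (to_tquot b)" if a: "a \<in> I" for a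
  proof -
    have eq: "TFrac a b * to_tquot b = to_tquot a"
      using b by (simp add: to_tquot_def TFrac_mult TFrac_eq_iff)
    then have "TFrac a b \<in> C"
      using H a by (auto simp: H_def mult.commute)
    then have "\<phi> (to_tquot a) = \<phi> (TFrac a b) * \<phi> (to_tquot b)" "\<phi> (TFrac a b) \<in> V"
      using ring_hom_mult[OF img(2), of "TFrac a b" "to_tquot b"] C eq img(1) by auto
    then show ?thesis
      by blast
  qed
qed

section \<open>The three claims, derived from the case of the greatest common divisor\<close>

theorem proposition3p9:
  fixes I :: "'a::comm_ring_1 set"
    and b :: 'a
    and \<phi> :: "'a tquot \<Rightarrow> 'f::field"
    and V N :: "'f set"
    and W Q U P :: "'f poly fract set"
    and k e :: nat
  assumes noetherian: "noetherian_ring (ring_of (UNIV :: 'a set))"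
    and ideal_I: "ideal I (ring_of UNIV)" "I \<noteq> UNIV" "\<exists>a\<in>I. nonzerodivisor a"
    and k: "k \<ge> 2"
    and V_rees: "rees_valuation_ring_through (range to_tquot) (to_tquot ` I) (to_tquot b) \<phi> V"
    and F: "quotient_field V = UNIV"
    and N: "maximalideal N (ring_of V)"
    and W_rees: "rees_valuation_ring (extended_rees_ring k I)
                   (PIdl\<^bsub>ring_of (extended_rees_ring k I)\<^esub> (u_root ^ k)) W"
    and W_corresponds: "W = corresponding_rees k V N (\<phi> (to_tquot b))"
    and Q: "maximalideal Q (ring_of W)"
    and U_itoh: "itoh_valuation_ring k I U"
    and U_corresponds: "U = integral_closure_in W UNIV"
    and P: "maximalideal P (ring_of U)"
    and IV: "Idl\<^bsub>ring_of V\<^esub> ((\<lambda>a. \<phi> (to_tquot a)) ` I) = N [^]\<^bsub>ideals_set (ring_of V)\<^esub> e"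
  shows "(k dvd e \<longrightarrow>
            P = Idl\<^bsub>ring_of U\<^esub> (const_rf ` N) \<and>
            has_quotient_field_degree U W k \<and>
            has_residue_degree U P W k) \<and>
         (coprime e k \<longrightarrow>
            Idl\<^bsub>ring_of U\<^esub> (const_rf ` N) = P [^]\<^bsub>ideals_set (ring_of U)\<^esub> k \<and>
            has_quotient_field_degree U W k \<and>
            (ring_of U Quot P) \<simeq> (ring_of W Quot Q)) \<and>
         (\<forall>c d :: nat. gcd e k = d \<and> c > 0 \<and> c * d = k \<longrightarrow>
            Idl\<^bsub>ring_of U\<^esub> (const_rf ` N) = P [^]\<^bsub>ideals_set (ring_of U)\<^esub> c \<and>
            has_quotient_field_degree U W k \<and>
            has_residue_degree U P W d)"
proof -
  define g where "g = \<phi> (to_tquot b)"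
  note gen = rees_valuation_ring_generator[OF V_rees, folded g_def]
  obtain v \<pi> where v: "int_valuation v" and V_eq: "V = {x. int_valuation.val_ge v 0 x}"
    and N_eq: "N = {x. int_valuation.val_ge v 1 x}" and \<pi>: "\<pi> \<noteq> 0" "v \<pi> = 1"
    by (rule dvr_valuation[OF gen(1) F N])
  interpret v: int_valuation v
    by (rule v)
  have cring_V: "cring (ring_of V)"
    unfolding V_eq using v.cring_val_ring[OF cring_ring_of_UNIV] by simp
  interpret V: cring "ring_of V"
    by (rule cring_V)
  \<comment> \<open>IV is principal: b lies in I, and the image of every element of I is a
    V-multiple of \<open>g\<close>.\<close>
  have "Idl\<^bsub>ring_of V\<^esub> ((\<lambda>a. \<phi> (to_tquot a)) ` I) = PIdl\<^bsub>ring_of V\<^esub> g"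
  proof (rule equalityI)
    have sub: "(\<lambda>a. \<phi> (to_tquot a)) ` I \<subseteq> PIdl\<^bsub>ring_of V\<^esub> g"
      using gen(4) by (auto simp: PIdl_ring_of)
    have g: "ideal (PIdl\<^bsub>ring_of V\<^esub> g) (ring_of V)"
      using gen(3) by (intro V.cgenideal_ideal) simp
    then show "Idl\<^bsub>ring_of V\<^esub> ((\<lambda>a. \<phi> (to_tquot a)) ` I) \<subseteq> PIdl\<^bsub>ring_of V\<^esub> g"
      using sub by (rule V.genideal_minimal)
    have "(\<lambda>a. \<phi> (to_tquot a)) ` I \<subseteq> carrier (ring_of V)"
      using sub ideal_ring_ofD(1)[OF g] by simp
    then show "PIdl\<^bsub>ring_of V\<^esub> g \<subseteq> Idl\<^bsub>ring_of V\<^esub> ((\<lambda>a. \<phi> (to_tquot a)) ` I)"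
      using V.genideal_self[of "(\<lambda>a. \<phi> (to_tquot a)) ` I"] gen(2)
      by (intro V.cgenideal_minimal V.genideal_ideal) (auto simp: g_def)
  qed
  then have Pg: "PIdl\<^bsub>ring_of V\<^esub> g = {x. v.val_ge (int e) x}"
    using IV v.val_ideal_pow[OF \<pi>, of e] by (simp add: V_eq N_eq)
  \<comment> \<open>Generators of gV = N^e are compared: \<pi>^e in gV forces g to be nonzero with
    value at most \<open>e\<close>, and g in N^e gives the opposite inequality.\<close>
  have "\<pi> ^ e \<in> {x. v.val_ge (int e) x}"
    using \<pi> by (simp add: v.val_ge_nonzero v.val_power)
  then have \<pi>_e: "\<pi> ^ e \<in> PIdl\<^bsub>ring_of V\<^esub> g"
    unfolding Pg .
  then have g: "g \<noteq> 0"
    using \<pi>(1) by (auto simp: PIdl_ring_of)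
  have "v.val_ge 0 g"
    using gen(3) by (simp add: V_eq)
  then have PIdl_g: "PIdl\<^bsub>ring_of V\<^esub> g = {x. v.val_ge (v g) x}"
    unfolding V_eq using g by (intro v.PIdl_val_ring) (simp_all add: v.val_ge_nonzero)
  have "g \<in> PIdl\<^bsub>ring_of V\<^esub> g"
    using gen(3) by (intro V.cgenideal_self) simp
  then have "v.val_ge (int e) g"
    unfolding Pg by simp
  moreover have "v.val_ge (v g) (\<pi> ^ e)"
    using \<pi>_e unfolding PIdl_g by simp
  ultimately have vg: "v g = int e"
    using \<pi> g by (simp add: v.val_ge_nonzero v.val_power)
  \<comment> \<open>The Itoh valuation ring is a discrete valuation ring, in particular a ring; this
    discharges the hypothesis of \<open>integral_closure_rees_eq\<close>.\<close>
  have cring_U: "cring (ring_of U)"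
    using U_itoh unfolding itoh_valuation_ring_def valuation_ring_through_def
      discrete_valuation_ring_def principal_domain_def domain_def by blast
  have main: "Idl\<^bsub>ring_of U\<^esub> (const_rf ` N) = P [^]\<^bsub>ideals_set (ring_of U)\<^esub> c \<and>
      has_quotient_field_degree U W k \<and> has_residue_degree U P W d \<and>
      ideal P (ring_of U) \<and> (d = 1 \<longrightarrow> ring_of U Quot P \<simeq> ring_of W Quot Q)"
    if cd: "gcd e k = d" "0 < c" "c * d = k" for c d
  proof -
    \<comment> \<open>The value of x: with e = ds and k = cd, both k s and c e equal c d s, as
      \<open>ks_eq\<close> demands.\<close>
    define s where "s = int (e div d)"
    have d: "0 < d" and e_eq: "e = d * (e div d)"
      using cd k by auto
    then have c_eq: "c = k div d"
      using cd(3) by auto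
    obtain w where "monomial_valuation v w (int c) s"
      using monomial_valuation_exists[OF v] by (metis of_nat_0_le_iff)
    moreover have "coprime s (int c)"
      unfolding s_def c_eq using div_gcd_coprime[of e k] cd(1) k by simp
    moreover have "int k * s = int c * v g"
      using arg_cong[OF e_eq, of int] cd(3) by (simp add: vg s_def flip: of_nat_mult) (metis mult.assoc)
    ultimately interpret K: kummer_uniformized v w c s k g d \<pi>
      using cd k g \<pi> d
      by (intro kummer_uniformized.intro kummer_monomial.intro kummer_monomial_axioms.intro
          kummer_uniformized_axioms.intro) auto
    have W: "W = K.W"
      unfolding W_corresponds V_eq N_eq g_def[symmetric] by (rule K.corresponding_rees_eq)
    have U: "U = K.U"
      using K.integral_closure_rees_eq cring_U unfolding U_corresponds W by blast
    have "maximalideal P (ring_of {x \<in> UNIV. K.val_ge 0 x})"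
      using P by (simp add: U)
    then have "P = {x \<in> UNIV. K.val_ge 1 x}"
      by (rule K.maximalideal_val_ring[OF cring_ring_of_UNIV, rotated]) simp
    then have P_eq: "P = K.P"
      by simp
    have Q_eq: "Q = {f \<in> K.subfield_L. K.val_ge 1 f}"
      using Q K.maximalideal_val_ring[OF K.cring_L] unfolding W by blast
    show ?thesis
      unfolding N_eq
      using K.ideal_N_U K.P_pow[of c] K.has_quotient_field_degree_L K.has_residue_degree_U
        K.residue_field_iso K.ideal_U[of 1]
      unfolding U W P_eq Q_eq by simp
  qed
  show ?thesis
  proof (intro conjI[of "k dvd e \<longrightarrow> _"] conjI[of "coprime e k \<longrightarrow> _"] impI allI)
    assume "k dvd e"
    then have *: "Idl\<^bsub>ring_of U\<^esub> (const_rf ` N) = P [^]\<^bsub>ideals_set (ring_of U)\<^esub> (1 :: nat)"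
      "has_quotient_field_degree U W k" "has_residue_degree U P W k" "ideal P (ring_of U)"
      using main[of k 1] k by (auto simp: gcd_nat.absorb2)
    interpret U: cring "ring_of U"
      by (rule cring_U)
    \<comment> \<open>The power is formed in the monoid of ideals, so that \<open>P\<close> is an
      ideal has to be known for its first power to be \<open>P\<close>.\<close>
    have "P [^]\<^bsub>ideals_set (ring_of U)\<^esub> (1 :: nat) = P"
      using monoid.nat_pow_eone[OF comm_monoid.axioms(1)[OF U.ideals_set_is_comm_monoid], of P] *(4)
      by (simp add: ideals_set_def)
    then show "P = Idl\<^bsub>ring_of U\<^esub> (const_rf ` N) \<and> has_quotient_field_degree U W k \<and>
        has_residue_degree U P W k"
      using * by simp
  next
    assume "coprime e k"
    then show "Idl\<^bsub>ring_of U\<^esub> (const_rf ` N) = P [^]\<^bsub>ideals_set (ring_of U)\<^esub> k \<and>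
        has_quotient_field_degree U W k \<and> ring_of U Quot P \<simeq> ring_of W Quot Q"
      using main[of 1 k] k by simp
  next
    fix c d :: nat
    assume "gcd e k = d \<and> c > 0 \<and> c * d = k"
    then show "Idl\<^bsub>ring_of U\<^esub> (const_rf ` N) = P [^]\<^bsub>ideals_set (ring_of U)\<^esub> c \<and>
        has_quotient_field_degree U W k \<and> has_residue_degree U P W d"
      using main[of d c] by blast
  qed
qed

end
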